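(* Let $k$ be a field with $\mathrm{char}(k)\neq 2$. (1) If $k$ does not contain a primitive fourth root of $1$, then $H^3_{\rm ab}(C_2\times C_2,k^* )\cong QF(C_2\times C_2,k^* )\cong C_2\times C_2\times C_2$; it has $8$ elements, each represented by an abelian $3$-cocycle whose underlying $3$-cocycle is trivial. (2) If $k$ contains a primitive fourth root of $1$, then $H^3_{\rm ab}(C_2\times C_2,k^* )\cong QF(C_2\times C_2,k^* )\cong C_4\times C_4\times C_2$. Of its $32$ elements, $8$ are represented by abelian $3$-cocycles with trivial underlying $3$-cocycle, and, for each of the three subsets $X\subseteq\{\sigma,\tau,\rho\}$ with $|X|=2$, exactly $8$ are represented by abelian $3$-cocycles with underlying $3$-cocycle $\phi_X$, these $24$ being the remaining elements.
   Context: $G=C_2\times C_2=\{e,\sigma,\tau,\rho\}$ is the Klein group, with $\sigma\tau=\tau\sigma=\rho$, $\sigma^2=\tau^2=e$. $k^*=k\setminus\{0\}$; $C_n$ is the cyclic group of order $n$. A $3$-cocycle is a map $\phi:G^3\to k^*$ with $\phi(y,z,t)\phi(x,yz,t)\phi(x,y,z)=\phi(xy,z,t)\phi(x,y,zt)$; it is normalized if $\phi(x,e,z)=1$ for all $x,z$. For $\psi:G^2\to k^*$, $\Delta_2(\psi)(x,y,z)=\psi(y,z)\psi(xy,z)^{-1}\psi(x,yz)\psi(x,y)^{-1}$. An abelian $3$-cocycle is a pair $(\phi,\mathcal R)$ with $\phi$ a normalized $3$-cocycle (the underlying $3$-cocycle) and $\mathcal R:G\times G\to k^*$ such that for all $x,y,z$: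 $\mathcal R(xy,z)\phi(x,z,y)=\phi(x,y,z)\mathcal R(x,z)\phi(z,x,y)\mathcal R(y,z)$ and $\phi(x,y,z)\mathcal R(x,yz)\phi(y,z,x)=\mathcal R(x,y)\phi(y,x,z)\mathcal R(x,z)$. These form a group under pointwise multiplication. Abelian coboundaries are the pairs $(\Delta_2(\psi),\mathcal R_\psi)$ with $\psi(e,x)=\psi(y,e)$ for all $x,y$, and $\mathcal R_\psi(x,y)=\psi(x,y)^{-1}\psi(y,x)$. $H^3_{\rm ab}(G,k^* )$ is the quotient group. $QF(G,k^* )$ is the group (pointwise multiplication) of maps $Q:G\to k^*$ with $Q(x^{-1})=Q(x)$ and $Q(xyz)Q(x)Q(y)Q(z)=Q(xy)Q(xz)Q(yz)$ for all $x,y,z\in G$. (Known theorem of Eilenberg and Mac Lane: $[(\phi,\mathcal R)]\mapsto (x\mapsto \mathcal R(x,x))$ is an isomorphism $H^3_{\rm ab}(G,k^* )\cong QF(G,k^* )$.) Definition of $\phi_X$ for $X\subseteq\{\sigma,\tau,\rho\}$: let $\varepsilon_x=-1$ if $x\in X$ and $\varepsilon_x=1$ otherwise, and $p=\varepsilon_\sigma\varepsilon_\tau\varepsilon_\rho$. Then $\phi_X:G^3\to k^*$ is the normalized $3$-cocycle, invariant under permuting its three arguments, such that $\phi_X$ is $1$ if one argument is $e$; $\phi_X(x,x,x)=\varepsilon_x$; $\phi_X(\sigma,\tau,\rho)=p$; $\phi_X(\tau,\sigma,\sigma)=1$; $\phi_X(\sigma,\tau,\tau)=p$; $\phi_X(\rho,\sigma,\sigma)=\varepsilon_\sigma$;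 $\phi_X(\sigma,\rho,\rho)=p\varepsilon_\sigma$; $\phi_X(\rho,\tau,\tau)=p\varepsilon_\tau$; $\phi_X(\tau,\rho,\rho)=\varepsilon_\tau$. *)

theory Defs
  imports
    "HOL-Algebra.Elementary_Groups"
    "HOL-Algebra.Product_Groups"
    "HOL-Library.Multiset"
begin

section \<open>Maps into the multiplicative group of a field\<close>

definition primitive_root_of_unity :: "nat \<Rightarrow> 'k::field \<Rightarrow> bool" where
  "primitive_root_of_unity n z \<longleftrightarrow>
     0 < n \<and> z ^ n = 1 \<and> (\<forall>m. 0 < m \<and> m < n \<longrightarrow> z ^ m \<noteq> 1)"

definition unit_group :: "'k::field monoid" where
  "unit_group = \<lparr>carrier = UNIV - {0}, monoid.mult = (*), one = 1\<rparr>"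

text \<open>
  The group of all maps from \<open>I\<close> to \<open>k\<^sup>*\<close> under pointwise multiplication. Its elements are
  extensional (undefined outside \<open>I\<close>), so that equality of maps only concerns their values on \<open>I\<close>.
\<close>

abbreviation unit_maps :: "'i set \<Rightarrow> ('i \<Rightarrow> 'k::field) monoid" where
  "unit_maps I \<equiv> product_group I (\<lambda>_. unit_group)"

abbreviation pairs :: "('g, 'm) monoid_scheme \<Rightarrow> ('g \<times> 'g) set" where
  "pairs G \<equiv> carrier G \<times> carrier G"

abbreviation triples :: "('g, 'm) monoid_scheme \<Rightarrow> ('g \<times> 'g \<times> 'g) set" where
  "triples G \<equiv> carrier G \<times> carrier G \<times> carrier G"


section \<open>The third abelian cohomology group\<close>

definition cocycle3 :: "('g, 'm) monoid_scheme \<Rightarrow> ('g \<times> 'g \<times> 'g \<Rightarrow> 'k::field) \<Rightarrow> bool" where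
  "cocycle3 G \<phi> \<longleftrightarrow>
     \<phi> \<in> carrier (unit_maps (triples G)) \<and>
     (\<forall>x\<in>carrier G. \<forall>y\<in>carrier G. \<forall>z\<in>carrier G. \<forall>t\<in>carrier G.
        \<phi> (y, z, t) * \<phi> (x, y \<otimes>\<^bsub>G\<^esub> z, t) * \<phi> (x, y, z) =
        \<phi> (x \<otimes>\<^bsub>G\<^esub> y, z, t) * \<phi> (x, y, z \<otimes>\<^bsub>G\<^esub> t))"

definition normalized_cocycle3 ::
    "('g, 'm) monoid_scheme \<Rightarrow> ('g \<times> 'g \<times> 'g \<Rightarrow> 'k::field) \<Rightarrow> bool" where
  "normalized_cocycle3 G \<phi> \<longleftrightarrow>
     cocycle3 G \<phi> \<and> (\<forall>x\<in>carrier G. \<forall>z\<in>carrier G. \<phi> (x, \<one>\<^bsub>G\<^esub>, z) = 1)"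

definition abelian_cocycle3 ::
    "('g, 'm) monoid_scheme \<Rightarrow> ('g \<times> 'g \<times> 'g \<Rightarrow> 'k::field) \<Rightarrow> ('g \<times> 'g \<Rightarrow> 'k) \<Rightarrow> bool" where
  "abelian_cocycle3 G \<phi> R \<longleftrightarrow>
     normalized_cocycle3 G \<phi> \<and>
     R \<in> carrier (unit_maps (pairs G)) \<and>
     (\<forall>x\<in>carrier G. \<forall>y\<in>carrier G. \<forall>z\<in>carrier G.
        R (x \<otimes>\<^bsub>G\<^esub> y, z) * \<phi> (x, z, y) =
          \<phi> (x, y, z) * R (x, z) * \<phi> (z, x, y) * R (y, z) \<and>
        \<phi> (x, y, z) * R (x, y \<otimes>\<^bsub>G\<^esub> z) * \<phi> (y, z, x) =
          R (x, y) * \<phi> (y, x, z) * R (x, z))"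

definition Delta2 ::
    "('g, 'm) monoid_scheme \<Rightarrow> ('g \<times> 'g \<Rightarrow> 'k::field) \<Rightarrow> 'g \<times> 'g \<times> 'g \<Rightarrow> 'k" where
  "Delta2 G \<psi> =
     restrict
       (\<lambda>(x, y, z). \<psi> (y, z) * inverse (\<psi> (x \<otimes>\<^bsub>G\<^esub> y, z)) * \<psi> (x, y \<otimes>\<^bsub>G\<^esub> z) * inverse (\<psi> (x, y)))
       (triples G)"

definition R_of :: "('g, 'm) monoid_scheme \<Rightarrow> ('g \<times> 'g \<Rightarrow> 'k::field) \<Rightarrow> 'g \<times> 'g \<Rightarrow> 'k" where
  "R_of G \<psi> = restrict (\<lambda>(x, y). inverse (\<psi> (x, y)) * \<psi> (y, x)) (pairs G)"

type_synonym ('g, 'k) abelian_cochain = "('g \<times> 'g \<times> 'g \<Rightarrow> 'k) \<times> ('g \<times> 'g \<Rightarrow> 'k)"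

definition Z3_ab ::
    "('g, 'm) monoid_scheme \<Rightarrow> 'k::field itself \<Rightarrow> ('g, 'k) abelian_cochain monoid" where
  "Z3_ab G _ =
     (unit_maps (triples G) \<times>\<times> unit_maps (pairs G))
       \<lparr>carrier := {(\<phi>, R). abelian_cocycle3 G \<phi> R}\<rparr>"

definition B3_ab ::
    "('g, 'm) monoid_scheme \<Rightarrow> 'k::field itself \<Rightarrow> ('g, 'k) abelian_cochain set" where
  "B3_ab G _ =
     {(Delta2 G \<psi>, R_of G \<psi>) | \<psi>.
        \<psi> \<in> carrier (unit_maps (pairs G)) \<and>
        (\<forall>x\<in>carrier G. \<forall>y\<in>carrier G. \<psi> (\<one>\<^bsub>G\<^esub>, x) = \<psi> (y, \<one>\<^bsub>G\<^esub>))}"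

definition H3_ab ::
    "('g, 'm) monoid_scheme \<Rightarrow> 'k::field itself \<Rightarrow> ('g, 'k) abelian_cochain set monoid" where
  "H3_ab G K = Z3_ab G K Mod B3_ab G K"

text \<open>
  The elements of \<^term>\<open>H3_ab G TYPE('k::field)\<close> are cosets, so a class is represented by exactly
  those abelian cocycles that are its members.
\<close>

definition classes_over ::
    "('g, 'm) monoid_scheme \<Rightarrow> ('g \<times> 'g \<times> 'g \<Rightarrow> 'k::field) \<Rightarrow> ('g, 'k) abelian_cochain set set" where
  "classes_over G \<phi> = {c \<in> carrier (H3_ab G TYPE('k)). \<exists>R. (\<phi>, R) \<in> c}"

abbreviation trivial_cocycle3 ::
    "('g, 'm) monoid_scheme \<Rightarrow> 'g \<times> 'g \<times> 'g \<Rightarrow> 'k::field" where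
  "trivial_cocycle3 G \<equiv> \<one>\<^bsub>unit_maps (triples G)\<^esub>"


section \<open>Quadratic functions\<close>

definition QF :: "('g, 'm) monoid_scheme \<Rightarrow> 'k::field itself \<Rightarrow> ('g \<Rightarrow> 'k) monoid" where
  "QF G _ =
     (unit_maps (carrier G))
       \<lparr>carrier := {Q \<in> carrier (unit_maps (carrier G)).
          (\<forall>x\<in>carrier G. Q (inv\<^bsub>G\<^esub> x) = Q x) \<and>
          (\<forall>x\<in>carrier G. \<forall>y\<in>carrier G. \<forall>z\<in>carrier G.
             Q (x \<otimes>\<^bsub>G\<^esub> y \<otimes>\<^bsub>G\<^esub> z) * Q x * Q y * Q z =
             Q (x \<otimes>\<^bsub>G\<^esub> y) * Q (x \<otimes>\<^bsub>G\<^esub> z) * Q (y \<otimes>\<^bsub>G\<^esub> z))}\<rparr>"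


section \<open>The Klein group and the cocycles attached to subsets of its involutions\<close>

abbreviation klein :: "(int \<times> int) monoid" where
  "klein \<equiv> integer_mod_group 2 \<times>\<times> integer_mod_group 2"

abbreviation kl_e :: "int \<times> int" where "kl_e \<equiv> (0, 0)"
abbreviation kl_sigma :: "int \<times> int" where "kl_sigma \<equiv> (1, 0)"
abbreviation kl_tau :: "int \<times> int" where "kl_tau \<equiv> (0, 1)"
abbreviation kl_rho :: "int \<times> int" where "kl_rho \<equiv> (1, 1)"

lemma comm_group_klein: "comm_group klein"
  by (rule group.group_comm_groupI[OF DirProd_group[OF group_integer_mod_group group_integer_mod_group]])
     (auto simp: DirProd_def integer_mod_group_def add.commute)

lemma klein_table:
  "carrier klein = {kl_e, kl_sigma, kl_tau, kl_rho}"
  "\<one>\<^bsub>klein\<^esub> = kl_e"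
  "kl_sigma \<otimes>\<^bsub>klein\<^esub> kl_tau = kl_rho" "kl_tau \<otimes>\<^bsub>klein\<^esub> kl_sigma = kl_rho"
  "kl_sigma \<otimes>\<^bsub>klein\<^esub> kl_sigma = kl_e" "kl_tau \<otimes>\<^bsub>klein\<^esub> kl_tau = kl_e"
  by (auto simp: DirProd_def integer_mod_group_def)

definition sgn_of :: "(int \<times> int) set \<Rightarrow> int \<times> int \<Rightarrow> 'k::field" where
  "sgn_of X x = (if x \<in> X then - 1 else 1)"

text \<open>
  The values are given on the multiset of the three arguments, which builds in the invariance under
  permutations. The final branch is the multiset of one \<open>\<tau>\<close> and two \<open>\<rho>\<close>, the only one left.
\<close>

definition phi_of :: "(int \<times> int) set \<Rightarrow> (int \<times> int) \<times> (int \<times> int) \<times> (int \<times> int) \<Rightarrow> 'k::field" where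
  "phi_of X =
     restrict
       (\<lambda>(x, y, z).
          let m = {#x, y, z#};
              p = sgn_of X kl_sigma * sgn_of X kl_tau * sgn_of X kl_rho
          in if kl_e \<in># m then 1
             else if x = y \<and> y = z then sgn_of X x
             else if m = {#kl_sigma, kl_tau, kl_rho#} then p
             else if m = {#kl_tau, kl_sigma, kl_sigma#} then 1
             else if m = {#kl_sigma, kl_tau, kl_tau#} then p
             else if m = {#kl_rho, kl_sigma, kl_sigma#} then sgn_of X kl_sigma
             else if m = {#kl_sigma, kl_rho, kl_rho#} then p * sgn_of X kl_sigma
             else if m = {#kl_rho, kl_tau, kl_tau#} then p * sgn_of X kl_tau
             else sgn_of X kl_tau)
       (triples klein)"


section \<open>Well-definedness\<close>

text \<open>
  The constructions above are commutative groups, the coboundaries form a subgroup of the cocycles,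
  and each \<^const>\<open>phi_of\<close> is indeed a normalized cocycle.
\<close>

lemma group_unit_group [simp]: "group (unit_group :: 'k::field monoid)"
proof (rule groupI)
  fix x :: 'k assume "x \<in> carrier unit_group"
  then show "\<exists>y\<in>carrier unit_group. y \<otimes>\<^bsub>unit_group\<^esub> x = \<one>\<^bsub>unit_group\<^esub>"
    by (intro bexI[of _ "inverse x"]) (auto simp: unit_group_def)
qed (auto simp: unit_group_def)

lemma inv_unit_group: "x \<noteq> 0 \<Longrightarrow> inv\<^bsub>unit_group\<^esub> (x :: 'k::field) = inverse x"
  by (rule group.inv_equality[OF group_unit_group]) (auto simp: unit_group_def)

lemma comm_group_Z3_ab:
  assumes "comm_group G"
  shows "comm_group (Z3_ab G TYPE('k::field))"
proof -
  interpret comm_group G by fact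
  let ?C = "unit_maps (triples G) \<times>\<times> unit_maps (pairs G) :: ('a,'k) abelian_cochain monoid"
  interpret C: group ?C by (intro DirProd_group) auto
  let ?Z = "{(\<phi>, R). abelian_cocycle3 G \<phi> (R :: _ \<Rightarrow> 'k)}"
  have sub: "subgroup ?Z ?C"
  proof (rule C.subgroupI)
    show "?Z \<subseteq> carrier ?C"
      by (auto simp: abelian_cocycle3_def normalized_cocycle3_def cocycle3_def)
    have "\<one>\<^bsub>?C\<^esub> \<in> ?Z"
      by (auto simp: abelian_cocycle3_def normalized_cocycle3_def cocycle3_def unit_group_def)
    then show "?Z \<noteq> {}" by blast
  next
    fix a assume "a \<in> ?Z"
    then obtain \<phi> R where a: "a = (\<phi>, R)" "abelian_cocycle3 G \<phi> R" by auto
    then have c: "\<phi> \<in> carrier (unit_maps (triples G))" "R \<in> carrier (unit_maps (pairs G))"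
      by (auto simp: abelian_cocycle3_def normalized_cocycle3_def cocycle3_def)
    have nz: "\<And>x. x \<in> triples G \<Longrightarrow> \<phi> x \<noteq> 0" "\<And>x. x \<in> pairs G \<Longrightarrow> R x \<noteq> 0"
      using c by (auto simp: unit_group_def PiE_iff)
    have i: "inv\<^bsub>?C\<^esub> a = (\<lambda>i\<in>triples G. inverse (\<phi> i), \<lambda>i\<in>pairs G. inverse (R i))"
      using c a nz by (subst a) (auto simp: inv_DirProd inv_unit_group intro!: restrict_ext)
    show "inv\<^bsub>?C\<^esub> a \<in> ?Z"
      using a(2) nz unfolding i
      by (auto simp: abelian_cocycle3_def normalized_cocycle3_def cocycle3_def unit_group_def
          inverse_mult_distrib[symmetric] simp del: inverse_mult_distrib)
  next
    fix a b assume "a \<in> ?Z" "b \<in> ?Z"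
    then obtain \<phi> R \<phi>' R' where ab: "a = (\<phi>, R)" "abelian_cocycle3 G \<phi> R"
        "b = (\<phi>', R')" "abelian_cocycle3 G \<phi>' R'" by auto
    have mm: "p * p' * (q * q') * (r * r') = s * s' * (t * (t' :: 'k))"
      if "p * q * r = s * t" "p' * q' * r' = s' * t'" for p q r s t p' q' r' s' t'
      using arg_cong2[where f = "(*)", OF that] by (simp only: mult_ac)
    have m2: "p * p' * (q * q') = r * r' * (s * s') * (t * t') * (u * (u' :: 'k))"
      if "p * q = r * s * t * u" "p' * q' = r' * s' * t' * u'" for p q r s t u p' q' r' s' t' u'
      using arg_cong2[where f = "(*)", OF that] by (simp only: mult_ac)
    have m3: "p * p' * (q * q') * (r * r') = s * s' * (t * t') * (u * (u' :: 'k))"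
      if "p * q * r = s * t * u" "p' * q' * r' = s' * t' * u'" for p q r s t u p' q' r' s' t' u'
      using arg_cong2[where f = "(*)", OF that] by (simp only: mult_ac)
    show "a \<otimes>\<^bsub>?C\<^esub> b \<in> ?Z"
      using ab(2,4) unfolding ab(1,3)
      by (auto simp: abelian_cocycle3_def normalized_cocycle3_def cocycle3_def unit_group_def PiE_iff
          intro!: mm m2 m3)
  qed
  show ?thesis
    unfolding Z3_ab_def
    using C.subgroup_imp_group[OF sub]
    by (rule group.group_comm_groupI)
       (auto simp: unit_group_def mult.commute intro!: restrict_ext)
qed

lemma subgroup_B3_ab:
  assumes "comm_group G"
  shows "subgroup (B3_ab G TYPE('k::field)) (Z3_ab G TYPE('k))"
proof -
  interpret comm_group G by fact
  interpret Z: comm_group "Z3_ab G TYPE('k)" by (rule comm_group_Z3_ab) fact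
  let ?P = "\<lambda>\<psi>. \<psi> \<in> carrier (unit_maps (pairs G)) \<and>
        (\<forall>x\<in>carrier G. \<forall>y\<in>carrier G. \<psi> (\<one>\<^bsub>G\<^esub>, x) = (\<psi> (y, \<one>\<^bsub>G\<^esub>) :: 'k))"
  let ?f = "\<lambda>\<psi>. (Delta2 G \<psi>, R_of G \<psi>)"
  have B: "B3_ab G TYPE('k) = {?f \<psi> | \<psi>. ?P \<psi>}" by (simp add: B3_ab_def)
  have in_Z: "?f \<psi> \<in> carrier (Z3_ab G TYPE('k))" if "?P \<psi>" for \<psi>
  proof -
    have nz: "\<psi> (x, y) \<noteq> 0" if "x \<in> carrier G" "y \<in> carrier G" for x y
      using that \<open>?P \<psi>\<close> by (auto simp: unit_group_def PiE_iff)
    have e: "\<psi> (\<one>\<^bsub>G\<^esub>, x) = \<psi> (y, \<one>\<^bsub>G\<^esub>)" if "x \<in> carrier G" "y \<in> carrier G" for x y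
      using that \<open>?P \<psi>\<close> by blast
    have n: "\<psi> (\<one>\<^bsub>G\<^esub>, z) * inverse (\<psi> (x, \<one>\<^bsub>G\<^esub>)) = 1" if "x \<in> carrier G" "z \<in> carrier G" for x z
      using e[of z x] that nz[of x "\<one>\<^bsub>G\<^esub>"] by simp
    have mem: "Delta2 G \<psi> \<in> carrier (unit_maps (triples G))" "R_of G \<psi> \<in> carrier (unit_maps (pairs G))"
      using nz by (auto simp: Delta2_def R_of_def unit_group_def)
    have "cocycle3 G (Delta2 G \<psi>)"
      unfolding cocycle3_def
      by (intro conjI mem ballI) (simp add: Delta2_def m_ac, simp add: nz divide_simps)
    moreover have "Delta2 G \<psi> (x, \<one>\<^bsub>G\<^esub>, z) = 1" if "x \<in> carrier G" "z \<in> carrier G" for x z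
      using that n[OF that] nz[of x z] nz[of x "\<one>\<^bsub>G\<^esub>"] by (simp add: Delta2_def divide_simps)
    ultimately have "normalized_cocycle3 G (Delta2 G \<psi>)"
      by (simp add: normalized_cocycle3_def)
    moreover have "R_of G \<psi> (x \<otimes>\<^bsub>G\<^esub> y, z) * Delta2 G \<psi> (x, z, y) =
          Delta2 G \<psi> (x, y, z) * R_of G \<psi> (x, z) * Delta2 G \<psi> (z, x, y) * R_of G \<psi> (y, z) \<and>
        Delta2 G \<psi> (x, y, z) * R_of G \<psi> (x, y \<otimes>\<^bsub>G\<^esub> z) * Delta2 G \<psi> (y, z, x) =
          R_of G \<psi> (x, y) * Delta2 G \<psi> (y, x, z) * R_of G \<psi> (x, z)"
      if "x \<in> carrier G" "y \<in> carrier G" "z \<in> carrier G" for x y z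
      using that by (simp add: Delta2_def R_of_def m_ac, simp add: nz divide_simps)
    ultimately show ?thesis
      using mem by (simp add: Z3_ab_def abelian_cocycle3_def)
  qed
  have mult: "?f \<psi> \<otimes>\<^bsub>Z3_ab G TYPE('k)\<^esub> ?f \<psi>' = ?f (\<lambda>i\<in>pairs G. \<psi> i * \<psi>' i)" for \<psi> \<psi>'
    by (auto simp: Z3_ab_def Delta2_def R_of_def unit_group_def intro!: restrict_ext)
  show ?thesis
  proof (rule Z.subgroupI)
    show "B3_ab G TYPE('k) \<subseteq> carrier (Z3_ab G TYPE('k))"
      using in_Z unfolding B by blast
    have "?P (\<lambda>i\<in>pairs G. 1)" by (auto simp: unit_group_def)
    then show "B3_ab G TYPE('k) \<noteq> {}" unfolding B by blast
  next
    fix a assume "a \<in> B3_ab G TYPE('k)"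
    then obtain \<psi> where a: "a = ?f \<psi>" "?P \<psi>" unfolding B by blast
    let ?i = "\<lambda>i\<in>pairs G. inverse (\<psi> i)"
    have P: "?P ?i" using a(2) by (auto simp: unit_group_def PiE_iff)
    have "?f ?i \<otimes>\<^bsub>Z3_ab G TYPE('k)\<^esub> ?f \<psi> = \<one>\<^bsub>Z3_ab G TYPE('k)\<^esub>"
      using a(2) unfolding mult
      by (auto simp: Z3_ab_def Delta2_def R_of_def unit_group_def PiE_iff intro!: restrict_ext)
    then have "inv\<^bsub>Z3_ab G TYPE('k)\<^esub> a = ?f ?i"
      using in_Z[OF a(2)] in_Z[OF P] unfolding a(1) by (rule Z.inv_equality)
    then show "inv\<^bsub>Z3_ab G TYPE('k)\<^esub> a \<in> B3_ab G TYPE('k)" using P unfolding B by blast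
  next
    fix a b assume "a \<in> B3_ab G TYPE('k)" "b \<in> B3_ab G TYPE('k)"
    then obtain \<psi> \<psi>' where ab: "a = ?f \<psi>" "?P \<psi>" "b = ?f \<psi>'" "?P \<psi>'" unfolding B by blast
    have "?P (\<lambda>i\<in>pairs G. \<psi> i * \<psi>' i)"
      using ab(2,4) by (auto simp: unit_group_def PiE_iff)
    then show "a \<otimes>\<^bsub>Z3_ab G TYPE('k)\<^esub> b \<in> B3_ab G TYPE('k)"
      unfolding ab mult B by blast
  qed
qed

lemma comm_group_QF:
  assumes "comm_group G"
  shows "comm_group (QF G TYPE('k::field))"
proof -
  interpret comm_group G by fact
  let ?C = "unit_maps (carrier G) :: ('a \<Rightarrow> 'k) monoid"
  interpret C: group ?C by (intro product_group) auto
  let ?Z = "carrier (QF G TYPE('k))"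
  have sub: "subgroup ?Z ?C"
  proof (rule C.subgroupI)
    show "?Z \<subseteq> carrier ?C" by (auto simp: QF_def)
    have "\<one>\<^bsub>?C\<^esub> \<in> ?Z" by (auto simp: QF_def unit_group_def)
    then show "?Z \<noteq> {}" by blast
  next
    fix a assume a: "a \<in> ?Z"
    then have nz: "\<And>x. x \<in> carrier G \<Longrightarrow> a x \<noteq> 0"
      by (auto simp: QF_def unit_group_def PiE_iff)
    have i: "inv\<^bsub>?C\<^esub> a = (\<lambda>i\<in>carrier G. inverse (a i))"
      using a nz by (subst inv_product_group) (auto simp: QF_def inv_unit_group intro!: restrict_ext)
    show "inv\<^bsub>?C\<^esub> a \<in> ?Z"
      using a nz unfolding i
      by (auto simp: QF_def unit_group_def inverse_mult_distrib[symmetric] simp del: inverse_mult_distrib)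
  next
    fix a b assume ab: "a \<in> ?Z" "b \<in> ?Z"
    have mm: "p * p' * (q * q') * (r * r') * (s * s') = t * t' * (u * u') * (v * (v' :: 'k))"
      if "p * q * r * s = t * u * v" "p' * q' * r' * s' = t' * u' * v'" for p q r s t u v p' q' r' s' t' u' v'
      using arg_cong2[where f = "(*)", OF that] by (simp only: mult_ac)
    show "a \<otimes>\<^bsub>?C\<^esub> b \<in> ?Z"
      using ab by (auto simp: QF_def unit_group_def PiE_iff intro!: mm)
  qed
  have "?C\<lparr>carrier := ?Z\<rparr> = QF G TYPE('k)" by (simp add: QF_def)
  then have "group (QF G TYPE('k))" using C.subgroup_imp_group[OF sub] by simp
  then show ?thesis
    by (rule group.group_comm_groupI)
       (auto simp: QF_def unit_group_def mult.commute intro!: restrict_ext)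
qed

lemma mset2_eq: "{#a, b#} = {#p, q#} \<longleftrightarrow> a = p \<and> b = q \<or> a = q \<and> b = p"
  by (auto simp: add_eq_conv_ex)

lemma mset3_eq: "{#a, b, c#} = {#p, q, r#} \<longleftrightarrow>
    a = p \<and> b = q \<and> c = r \<or> a = p \<and> b = r \<and> c = q \<or> a = q \<and> b = p \<and> c = r \<or>
    a = q \<and> b = r \<and> c = p \<or> a = r \<and> b = p \<and> c = q \<or> a = r \<and> b = q \<and> c = p"
  by (auto simp: add_eq_conv_ex)

lemma klein_mult: "(a, b) \<otimes>\<^bsub>klein\<^esub> (c, d) = ((a + c) mod 2, (b + d) mod 2)"
  by (simp add: DirProd_def integer_mod_group_def)

lemma cocycle_phi_of: "normalized_cocycle3 klein (phi_of X :: _ \<Rightarrow> 'k::field)"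
proof -
  have one: "phi_of X (a, b, c) = (1::'k)" if "kl_e \<in> {a, b, c}" "{a,b,c} \<subseteq> carrier klein" for a b c
    using that by (auto simp: phi_of_def)
  have sgn: "sgn_of X x * sgn_of X x = (1::'k)" for x
    by (simp add: sgn_of_def)
  then have sgn': "sgn_of X x * (sgn_of X x * y) = y" for x and y :: 'k
    by (simp flip: mult.assoc)
  have nz: "sgn_of X x \<noteq> (0::'k)" for x by (simp add: sgn_of_def)
  define f where "f = (phi_of X :: _ \<Rightarrow> 'k)"
  define s t r where str: "s = (sgn_of X kl_sigma :: 'k)" "t = (sgn_of X kl_tau :: 'k)" "r = (sgn_of X kl_rho :: 'k)"
  have K: "carrier klein = {kl_e, kl_sigma, kl_tau, kl_rho}" by (rule klein_table)
  have one': "f (kl_e, b, c) = 1" "f (b, kl_e, c) = 1" "f (b, c, kl_e) = 1"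
    if "b \<in> carrier klein" "c \<in> carrier klein" for b c
    using one[of kl_e b c] one[of b kl_e c] one[of b c kl_e] that K
    unfolding f_def by simp_all
  note o = one'[unfolded K]
  have T: "f (kl_sigma, kl_sigma, kl_sigma) = s" "f (kl_tau, kl_tau, kl_tau) = t" "f (kl_rho, kl_rho, kl_rho) = r"
    "f (kl_sigma, kl_tau, kl_rho) = s*t*r" "f (kl_sigma, kl_rho, kl_tau) = s*t*r" "f (kl_tau, kl_sigma, kl_rho) = s*t*r"
    "f (kl_tau, kl_rho, kl_sigma) = s*t*r" "f (kl_rho, kl_tau, kl_sigma) = s*t*r" "f (kl_rho, kl_sigma, kl_tau) = s*t*r"
    "f (kl_tau, kl_sigma, kl_sigma) = 1" "f (kl_sigma, kl_tau, kl_sigma) = 1" "f (kl_sigma, kl_sigma, kl_tau) = 1"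
    "f (kl_sigma, kl_tau, kl_tau) = s*t*r" "f (kl_tau, kl_sigma, kl_tau) = s*t*r" "f (kl_tau, kl_tau, kl_sigma) = s*t*r"
    "f (kl_rho, kl_sigma, kl_sigma) = s" "f (kl_sigma, kl_rho, kl_sigma) = s" "f (kl_sigma, kl_sigma, kl_rho) = s"
    "f (kl_sigma, kl_rho, kl_rho) = s*t*r*s" "f (kl_rho, kl_sigma, kl_rho) = s*t*r*s" "f (kl_rho, kl_rho, kl_sigma) = s*t*r*s"
    "f (kl_rho, kl_tau, kl_tau) = s*t*r*t" "f (kl_tau, kl_rho, kl_tau) = s*t*r*t" "f (kl_tau, kl_tau, kl_rho) = s*t*r*t"
    "f (kl_tau, kl_rho, kl_rho) = t" "f (kl_rho, kl_tau, kl_rho) = t" "f (kl_rho, kl_rho, kl_tau) = t"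
    unfolding f_def str by (simp_all add: phi_of_def K Let_def mset2_eq mset3_eq)
  have q: "s * s = 1" "t * t = 1" "r * r = 1" "s * (s * y) = y" "t * (t * y) = y" "r * (r * y) = y" for y
    unfolding str by (simp_all add: sgn sgn')
  have "f (y, z, u) * f (x, y \<otimes>\<^bsub>klein\<^esub> z, u) * f (x, y, z) =
        f (x \<otimes>\<^bsub>klein\<^esub> y, z, u) * f (x, y, z \<otimes>\<^bsub>klein\<^esub> u)"
    if "x \<in> carrier klein" "y \<in> carrier klein" "z \<in> carrier klein" "u \<in> carrier klein" for x y z u
    using that unfolding K
    by (elim insertE emptyE) (simp_all add: klein_mult o T q mult.assoc mult.commute mult.left_commute)
  moreover have "f \<in> carrier (unit_maps (triples klein))"
  proof -
    have "f (x, y, z) \<noteq> 0" if "x \<in> carrier klein" "y \<in> carrier klein" "z \<in> carrier klein" for x y z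
      using that nz unfolding K by (elim insertE emptyE) (simp_all add: o T str)
    then show ?thesis by (auto simp: PiE_iff unit_group_def) (simp add: f_def phi_of_def)
  qed
  moreover have "f (x, \<one>\<^bsub>klein\<^esub>, z) = 1" if "x \<in> carrier klein" "z \<in> carrier klein" for x z
    using that unfolding klein_table(2) by (simp add: one')
  ultimately show ?thesis
    by (simp add: normalized_cocycle3_def cocycle3_def flip: f_def)
qed

end

theory Submission
  imports Defs
begin

text \<open>
  The diagonal \<open>Q(x) = R(x, x)\<close> of an abelian cocycle \<open>(\<phi>, R)\<close>, here called its trace, is a quadratic
  function. For the Klein group the induced map from cohomology to quadratic functions is shown to be
  an isomorphism by hand.

  Injectivity (\<open>klein_trivial_trace_coboundary\<close>): if the trace is trivial then
  \<open>R(x, y) R(y, x) = 1\<close>, because in general \<open>R(xy, xy) = R(x, x) R(y, y) R(x, y) R(y, x)\<close>. An explicit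
  \<open>2\<close>-cochain therefore removes all of \<open>R\<close> and, at the same time, three values of \<open>\<phi>\<close>. Once \<open>R\<close> is
  constantly \<open>1\<close> the hexagons become shuffle relations, and with the pentagon they force \<open>\<phi> = 1\<close>.

  Surjectivity (\<open>abelian_cocycle3_klein_braiding\<close>): a quadratic function is given by its values
  \<open>s, t, r\<close> at \<open>\<sigma>, \<tau>, \<rho>\<close>, subject to \<open>s\<^sup>4 = t\<^sup>4 = 1\<close> and \<open>r\<^sup>2 = s\<^sup>2t\<^sup>2\<close>. Its pullback to \<open>\<int>\<^sup>2\<close> is the
  diagonal of a bicharacter. Restricting this bicharacter to the representatives \<open>0, 1\<close> breaks bilinearity only at
  the carry \<open>1 + 1 = 0\<close>, where the error is \<open>s\<^sup>2\<close> or \<open>t\<^sup>2\<close>, hence a sign; these errors are exactly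
  the values of \<open>\<phi>\<^sub>X\<close> for \<open>X = {x. Q(x)\<^sup>2 \<noteq> 1}\<close>.

  Conversely the hexagon at \<open>(x, x, x)\<close> gives \<open>R(x, x)\<^sup>2 = \<phi>(x, x, x)\<close>, so a class with trace \<open>Q\<close> has a
  representative over \<open>\<phi>\<^sub>X\<close> only for this \<open>X\<close> (\<open>klein_class_over_iff\<close>). The relation
  \<open>r\<^sup>2 = s\<^sup>2t\<^sup>2\<close> makes \<open>|X|\<close> even, and \<open>\<phi>\<^sub>X\<close> is trivial for empty \<open>X\<close>. Everything else is counting triples
  \<open>(s, t, \<plusminus>st)\<close> of fourth roots of unity.
\<close>

section \<open>The trace of an abelian cocycle\<close>

locale abelian_cocycle = comm_group G for G (structure) +
  fixes \<phi> :: "'a \<times> 'a \<times> 'a \<Rightarrow> 'k::field" and R :: "'a \<times> 'a \<Rightarrow> 'k"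
  assumes abelian_cocycle: "abelian_cocycle3 G \<phi> R"
begin

lemma phi_nonzero:
  assumes "x \<in> carrier G" "y \<in> carrier G" "z \<in> carrier G"
  shows "\<phi> (x, y, z) \<noteq> 0"
  using abelian_cocycle assms
  by (auto simp: abelian_cocycle3_def normalized_cocycle3_def cocycle3_def unit_group_def PiE_iff)

lemma R_nonzero:
  assumes "x \<in> carrier G" "y \<in> carrier G"
  shows "R (x, y) \<noteq> 0"
  using abelian_cocycle assms by (auto simp: abelian_cocycle3_def unit_group_def PiE_iff)

lemma pentagon:
  assumes "x \<in> carrier G" "y \<in> carrier G" "z \<in> carrier G" "t \<in> carrier G"
  shows "\<phi> (y, z, t) * \<phi> (x, y \<otimes> z, t) * \<phi> (x, y, z) = \<phi> (x \<otimes> y, z, t) * \<phi> (x, y, z \<otimes> t)"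
  using abelian_cocycle assms
  by (auto simp: abelian_cocycle3_def normalized_cocycle3_def cocycle3_def)

lemma hexagon_left:
  assumes "x \<in> carrier G" "y \<in> carrier G" "z \<in> carrier G"
  shows "R (x \<otimes> y, z) * \<phi> (x, z, y) = \<phi> (x, y, z) * R (x, z) * \<phi> (z, x, y) * R (y, z)"
  using abelian_cocycle assms by (auto simp: abelian_cocycle3_def)

lemma hexagon_right:
  assumes "x \<in> carrier G" "y \<in> carrier G" "z \<in> carrier G"
  shows "\<phi> (x, y, z) * R (x, y \<otimes> z) * \<phi> (y, z, x) = R (x, y) * \<phi> (y, x, z) * R (x, z)"
  using abelian_cocycle assms by (auto simp: abelian_cocycle3_def)

lemma phi_one_middle:
  assumes "x \<in> carrier G" "z \<in> carrier G"
  shows "\<phi> (x, \<one>, z) = 1"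
  using abelian_cocycle assms by (auto simp: abelian_cocycle3_def normalized_cocycle3_def)

lemma phi_one_left:
  assumes "y \<in> carrier G" "z \<in> carrier G"
  shows "\<phi> (\<one>, y, z) = 1"
  using pentagon[of \<one> \<one> y z] assms by (simp add: phi_one_middle phi_nonzero)

lemma phi_one_right:
  assumes "x \<in> carrier G" "y \<in> carrier G"
  shows "\<phi> (x, y, \<one>) = 1"
  using pentagon[of x y \<one> \<one>] assms by (simp add: phi_one_middle phi_nonzero)

lemma R_one_left:
  assumes "x \<in> carrier G"
  shows "R (\<one>, x) = 1"
  using hexagon_left[of \<one> \<one> x] assms
  by (simp add: phi_one_middle phi_one_left phi_one_right R_nonzero)

lemma R_one_right:
  assumes "x \<in> carrier G"
  shows "R (x, \<one>) = 1"
  using hexagon_right[of x \<one> \<one>] assms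
  by (simp add: phi_one_middle phi_one_left phi_one_right R_nonzero)

text \<open>
  The associator terms in the hexagons for \<open>R (x \<otimes> y, z)\<close> and \<open>R (z, x \<otimes> y)\<close> are inverse to each
  other, so the double braiding is a bicharacter even though \<open>R\<close> is not.
\<close>

definition double_braiding :: "'a \<Rightarrow> 'a \<Rightarrow> 'k" where
  "double_braiding x y = R (x, y) * R (y, x)"

lemma double_braiding_mult_left:
  assumes "x \<in> carrier G" "y \<in> carrier G" "z \<in> carrier G"
  shows "double_braiding (x \<otimes> y) z = double_braiding x z * double_braiding y z"
proof -
  let ?c = "\<phi> (x, z, y) * \<phi> (z, x, y) * \<phi> (x, y, z)"
  have "?c * double_braiding (x \<otimes> y) z = ?c * (double_braiding x z * double_braiding y z)"
    using arg_cong2[where f = "(*)", OF hexagon_left[of x y z] hexagon_right[of z x y]] assms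
    unfolding double_braiding_def by (simp only: mult_ac)
  moreover have "?c \<noteq> 0" using assms by (simp add: phi_nonzero)
  ultimately show ?thesis by simp
qed

text \<open>
  Expanding \<open>R (x \<otimes> y, x \<otimes> y)\<close> by the hexagons leaves an associator factor, which is \<open>1\<close> by the
  pentagon for the quadruple \<open>(x, y, x, y)\<close>.
\<close>

lemma trace_mult:
  assumes "x \<in> carrier G" "y \<in> carrier G"
  shows "R (x \<otimes> y, x \<otimes> y) = R (x, x) * R (y, y) * double_braiding x y"
proof -
  let ?p = "x \<otimes> y"
  \<comment> \<open>the factors that occur on both sides of the product of three hexagons and the pentagon\<close>
  let ?c = "\<phi> (x, ?p, y) * \<phi> (x, x, y) * \<phi> (x, y, x) * \<phi> (y, x, y) * \<phi> (x, y, y)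
    * \<phi> (x, y, ?p) * \<phi> (?p, x, y) * R (x, ?p) * R (y, ?p)"
  have p: "?p \<in> carrier G" using assms by simp
  have "?c * R (?p, ?p) = ?c * (R (x, x) * R (y, y) * double_braiding x y)"
  proof -
    note h = hexagon_left[OF assms p] hexagon_right[OF assms(1) assms]
      hexagon_right[OF assms(2) assms]
      pentagon[OF assms assms, symmetric, unfolded m_comm[OF assms(2,1)]]
    show ?thesis
      using arg_cong2[where f = "(*)", OF arg_cong2[where f = "(*)", OF h(1,2)]
          arg_cong2[where f = "(*)", OF h(3,4)]]
      unfolding double_braiding_def by (simp only: mult_ac)
  qed
  moreover have "?c \<noteq> 0" using assms p by (simp add: phi_nonzero R_nonzero)
  ultimately show ?thesis by simp
qed

text \<open>
  The bicharacter property gives \<open>b(x, x\<inverse>) = b(x, x)\<inverse> = Q(x)\<^bsup>-2\<^esup>\<close> for the double braiding \<open>b\<close>, while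
  \<open>1 = Q(x x\<inverse>) = Q(x) Q(x\<inverse>) b(x, x\<inverse>)\<close>.
\<close>

lemma trace_inverse:
  assumes x: "x \<in> carrier G"
  shows "R (inv x, inv x) = R (x, x)"
proof -
  have "double_braiding x x * double_braiding (inv x) x = double_braiding \<one> x"
    using double_braiding_mult_left[of x "inv x" x] x by simp
  then have "double_braiding x x * double_braiding (inv x) x = 1"
    using x by (simp add: double_braiding_def R_one_left R_one_right)
  then have sq: "(R (x, x))\<^sup>2 * double_braiding x (inv x) = 1"
    by (simp add: double_braiding_def power2_eq_square mult_ac)
  have "R (x, x) * R (inv x, inv x) * double_braiding x (inv x) = 1"
    using trace_mult[of x "inv x"] x by (simp add: R_one_left)
  then have "R (x, x) * R (inv x, inv x) * double_braiding x (inv x)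
      = R (x, x) * R (x, x) * double_braiding x (inv x)"
    using sq by (simp add: power2_eq_square)
  moreover have "R (x, x) * double_braiding x (inv x) \<noteq> 0"
    using x by (simp add: R_nonzero double_braiding_def)
  ultimately show ?thesis by simp
qed

text \<open>Both sides of the cubical identity are \<open>Q(x)\<^sup>2 Q(y)\<^sup>2 Q(z)\<^sup>2\<close> times the three double braidings.\<close>

lemma trace_cubical:
  assumes "x \<in> carrier G" "y \<in> carrier G" "z \<in> carrier G"
  shows "R (x \<otimes> y \<otimes> z, x \<otimes> y \<otimes> z) * R (x, x) * R (y, y) * R (z, z)
    = R (x \<otimes> y, x \<otimes> y) * R (x \<otimes> z, x \<otimes> z) * R (y \<otimes> z, y \<otimes> z)"
  using assms trace_mult[of "x \<otimes> y" z] trace_mult[of x z] trace_mult[of y z]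
    double_braiding_mult_left[of x y z]
  by (simp add: mult_ac)

text \<open>
  This is what ties the trace to the underlying cocycle: the diagonal of \<open>\<phi>\<close> at an involution can be
  read off from the trace.
\<close>

lemma R_square_involution:
  assumes x: "x \<in> carrier G" and "x \<otimes> x = \<one>"
  shows "(R (x, x))\<^sup>2 = \<phi> (x, x, x)"
  using hexagon_right[of x x x] assms by (simp add: R_one_right phi_nonzero power2_eq_square)

end

definition trace :: "('g, 'm) monoid_scheme \<Rightarrow> ('g, 'k::field) abelian_cochain \<Rightarrow> 'g \<Rightarrow> 'k" where
  "trace G c = (\<lambda>x\<in>carrier G. snd c (x, x))"

lemma trace_in_QF:
  assumes "comm_group G" "abelian_cocycle3 G \<phi> (R :: _ \<Rightarrow> 'k::field)"
  shows "trace G (\<phi>, R) \<in> carrier (QF G TYPE('k))"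
proof -
  interpret abelian_cocycle G \<phi> R
    using assms by (intro abelian_cocycle.intro abelian_cocycle_axioms.intro)
  show ?thesis
    by (auto simp: trace_def QF_def unit_group_def R_nonzero trace_inverse trace_cubical)
qed

lemma group_hom_trace:
  assumes "comm_group G"
  shows "group_hom (Z3_ab G TYPE('k::field)) (QF G TYPE('k)) (trace G)"
proof -
  interpret Z: comm_group "Z3_ab G TYPE('k)" by (rule comm_group_Z3_ab) fact
  interpret Q: comm_group "QF G TYPE('k)" by (rule comm_group_QF) fact
  have "trace G \<in> hom (Z3_ab G TYPE('k)) (QF G TYPE('k))"
  proof (rule homI)
    fix c assume "c \<in> carrier (Z3_ab G TYPE('k))"
    then show "trace G c \<in> carrier (QF G TYPE('k))"
      using trace_in_QF[OF assms] by (auto simp: Z3_ab_def)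
  next
    fix c d :: "('a, 'k) abelian_cochain"
    show "trace G (c \<otimes>\<^bsub>Z3_ab G TYPE('k)\<^esub> d) = trace G c \<otimes>\<^bsub>QF G TYPE('k)\<^esub> trace G d"
      by (cases c; cases d)
         (auto simp: trace_def Z3_ab_def QF_def unit_group_def intro!: restrict_ext)
  qed
  then show ?thesis
    by (intro group_hom.intro group_hom_axioms.intro Z.group_axioms Q.group_axioms)
qed


section \<open>Abelian cocycles of the Klein group with trivial trace\<close>

context abelian_cocycle
begin

lemma trivial_braiding_shuffle:
  assumes "\<forall>x\<in>carrier G. \<forall>y\<in>carrier G. R (x, y) = 1"
    and "x \<in> carrier G" "y \<in> carrier G" "z \<in> carrier G"
  shows "\<phi> (x, z, y) = \<phi> (x, y, z) * \<phi> (z, x, y)"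
  using hexagon_left[of x y z] assms by simp

lemma trivial_braiding_flank:
  assumes R: "\<forall>x\<in>carrier G. \<forall>y\<in>carrier G. R (x, y) = 1"
    and "x \<in> carrier G" "y \<in> carrier G"
  shows "\<phi> (x, y, x) = 1"
  using trivial_braiding_shuffle[OF R, of x y x] assms(2,3) by (simp add: phi_nonzero)

text \<open>
  Two applications of the shuffle relation return to the starting triple and show that the product of
  \<open>\<phi>\<close> over the cyclic rotations of a triple is \<open>1\<close>; one more application turns this into the
  antisymmetry under reversal.
\<close>

lemma trivial_braiding_reverse:
  assumes R: "\<forall>x\<in>carrier G. \<forall>y\<in>carrier G. R (x, y) = 1"
    and xyz: "x \<in> carrier G" "y \<in> carrier G" "z \<in> carrier G"
  shows "\<phi> (z, y, x) = inverse (\<phi> (x, y, z))"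
proof -
  note s = trivial_braiding_shuffle[OF R]
  have "\<phi> (x, y, z) = \<phi> (x, z, y) * \<phi> (y, x, z)" using xyz by (intro s[of x z y])
  also have "\<dots> = \<phi> (x, y, z) * (\<phi> (z, x, y) * \<phi> (y, z, x) * \<phi> (x, y, z))"
    using xyz by (simp only: s[of x y z] s[of y z x] mult_ac)
  finally have "\<phi> (z, x, y) * \<phi> (y, z, x) * \<phi> (x, y, z) = 1"
    using xyz by (simp add: phi_nonzero)
  then have "\<phi> (z, y, x) * \<phi> (x, y, z) = 1"
    using xyz by (simp only: s[of z x y])
  then show ?thesis by (metis inverse_unique mult.commute)
qed

end

text \<open>
  With trivial \<open>R\<close> the shuffle relations leave few independent values of \<open>\<phi>\<close>. Three of them are
  normalized by assumption. In the instances of the pentagon chosen below, taken in this order, only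
  one value is not yet known.
\<close>

lemma klein_trivial_of_trivial_braiding:
  assumes "abelian_cocycle klein \<phi> (R :: _ \<Rightarrow> 'k::field)"
    and R: "\<forall>x\<in>carrier klein. \<forall>y\<in>carrier klein. R (x, y) = 1"
    and gauge: "\<phi> (kl_sigma, kl_sigma, kl_tau) = 1" "\<phi> (kl_sigma, kl_tau, kl_tau) = 1"
      "\<phi> (kl_rho, kl_sigma, kl_tau) = 1"
    and "x \<in> carrier klein" "y \<in> carrier klein" "z \<in> carrier klein"
  shows "\<phi> (x, y, z) = 1"
proof -
  interpret abelian_cocycle klein \<phi> R by fact
  note K = klein_table(1)
  note flank = trivial_braiding_flank[OF R, unfolded K]
  note reverse = trivial_braiding_reverse[OF R, unfolded K]
  note pent = pentagon[unfolded K]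
  note unit = phi_one_left[unfolded K klein_table(2)] phi_one_middle[unfolded K klein_table(2)]
    phi_one_right[unfolded K klein_table(2)]
  have rev: "\<phi> (kl_tau, kl_sigma, kl_sigma) = 1" "\<phi> (kl_tau, kl_tau, kl_sigma) = 1"
    "\<phi> (kl_tau, kl_sigma, kl_rho) = 1"
    using gauge reverse[of kl_sigma kl_sigma kl_tau] reverse[of kl_sigma kl_tau kl_tau]
      reverse[of kl_rho kl_sigma kl_tau] by simp_all
  have "\<phi> (kl_sigma, kl_sigma, kl_rho) = 1"
    using pent[of kl_sigma kl_sigma kl_sigma kl_tau] by (simp add: klein_mult gauge unit flank)
  moreover have "\<phi> (kl_tau, kl_tau, kl_rho) = 1"
    using pent[of kl_tau kl_tau kl_tau kl_sigma] by (simp add: klein_mult rev unit flank)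
  moreover from this have "\<phi> (kl_rho, kl_tau, kl_tau) = 1"
    using reverse[of kl_tau kl_tau kl_rho] by simp
  moreover from this have "\<phi> (kl_rho, kl_rho, kl_sigma) = 1"
    using pent[of kl_rho kl_rho kl_sigma kl_tau] by (simp add: klein_mult gauge unit flank)
  moreover from this have "\<phi> (kl_rho, kl_rho, kl_tau) = 1"
    using pent[of kl_rho kl_rho kl_rho kl_sigma] by (simp add: klein_mult unit flank)
  moreover have "\<phi> (kl_sigma, kl_rho, kl_tau) = 1"
    using pent[of kl_sigma kl_sigma kl_tau kl_tau] by (simp add: klein_mult gauge unit flank)
  moreover from this have "\<phi> (kl_sigma, kl_tau, kl_rho) = 1"
    using trivial_braiding_shuffle[OF R, unfolded K, of kl_sigma kl_tau kl_rho] gauge by simp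
  ultimately show ?thesis
    using assms(6-8) rev gauge unfolding K
    by (elim insertE emptyE)
       (simp_all add: unit flank reverse[of kl_sigma kl_sigma kl_rho] reverse[of kl_rho kl_rho kl_sigma]
        reverse[of kl_rho kl_rho kl_tau] reverse[of kl_sigma kl_rho kl_tau] reverse[of kl_sigma kl_tau kl_rho])
qed

text \<open>
  A cochain \<open>\<psi>\<close> with \<open>R \<cdot> R\<^sub>\<psi> = 1\<close> and \<open>\<phi> \<cdot> \<Delta>\<^sub>2(\<psi>) = 1\<close>. The values at \<open>(\<sigma>, \<sigma>)\<close>, \<open>(\<tau>, \<tau>)\<close> and \<open>(\<sigma>, \<tau>)\<close> can
  be chosen freely, since changing them amounts to multiplying \<open>\<psi>\<close> by a symmetric \<open>2\<close>-cocycle; here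
  they are \<open>1\<close>. The second equation at \<open>(\<sigma>, \<sigma>, \<tau>)\<close>, \<open>(\<sigma>, \<tau>, \<tau>)\<close> and \<open>(\<rho>, \<sigma>, \<tau>)\<close> then determines \<open>\<psi>\<close> at
  \<open>(\<sigma>, \<rho>)\<close>, \<open>(\<rho>, \<tau>)\<close> and \<open>(\<rho>, \<rho>)\<close>, and the first equation determines \<open>\<psi>(y, x)\<close> from \<open>\<psi>(x, y)\<close>.
\<close>

definition gauge_cochain ::
    "((int \<times> int) \<times> (int \<times> int) \<times> (int \<times> int) \<Rightarrow> 'k::field) \<Rightarrow> ((int \<times> int) \<times> (int \<times> int) \<Rightarrow> 'k) \<Rightarrow>
      (int \<times> int) \<times> (int \<times> int) \<Rightarrow> 'k" where
  "gauge_cochain \<phi> R =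
     restrict
       (\<lambda>p. if p = (kl_tau, kl_sigma) then R (kl_tau, kl_sigma)
          else if p = (kl_sigma, kl_rho) then inverse (\<phi> (kl_sigma, kl_sigma, kl_tau))
          else if p = (kl_rho, kl_sigma)
            then inverse (\<phi> (kl_sigma, kl_sigma, kl_tau)) * R (kl_rho, kl_sigma)
          else if p = (kl_rho, kl_tau) then \<phi> (kl_sigma, kl_tau, kl_tau)
          else if p = (kl_tau, kl_rho) then \<phi> (kl_sigma, kl_tau, kl_tau) * R (kl_tau, kl_rho)
          else if p = (kl_rho, kl_rho)
            then inverse (\<phi> (kl_sigma, kl_sigma, kl_tau)) * R (kl_rho, kl_sigma)
              * inverse (\<phi> (kl_rho, kl_sigma, kl_tau))
          else 1)
       (pairs klein)"

lemma mult_Z3_ab: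
  "c \<otimes>\<^bsub>Z3_ab G TYPE('k::field)\<^esub> d =
     (\<lambda>i\<in>triples G. fst c i * fst d i, \<lambda>i\<in>pairs G. snd c i * snd d i)"
  by (cases c; cases d) (simp add: Z3_ab_def unit_group_def)

lemma one_Z3_ab: "\<one>\<^bsub>Z3_ab G TYPE('k::field)\<^esub> = (trivial_cocycle3 G, \<lambda>i\<in>pairs G. 1)"
  by (simp add: Z3_ab_def unit_group_def)

lemma klein_trivial_trace_coboundary:
  assumes c: "c \<in> carrier (Z3_ab klein TYPE('k::field))"
    and tr: "trace klein c = \<one>\<^bsub>QF klein TYPE('k)\<^esub>"
  shows "c \<in> B3_ab klein TYPE('k)"
proof -
  interpret Z: comm_group "Z3_ab klein TYPE('k)" by (rule comm_group_Z3_ab[OF comm_group_klein])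
  interpret B: subgroup "B3_ab klein TYPE('k)" "Z3_ab klein TYPE('k)"
    by (rule subgroup_B3_ab[OF comm_group_klein])
  obtain \<phi> R where cR: "c = (\<phi>, R)" by (cases c)
  interpret C: abelian_cocycle klein \<phi> R
    using c comm_group_klein unfolding cR Z3_ab_def
    by (intro abelian_cocycle.intro abelian_cocycle_axioms.intro) simp_all
  note K = klein_table(1)
  have diag: "R (x, x) = 1" if "x \<in> carrier klein" for x
    using fun_cong[OF tr, of x] that unfolding cR by (simp add: trace_def QF_def unit_group_def)
  have antisym: "R (x, y) * R (y, x) = 1" if "x \<in> carrier klein" "y \<in> carrier klein" for x y
    using C.trace_mult[OF that] diag[OF C.m_closed[OF that]] diag that
    by (simp add: C.double_braiding_def)
  note nz = C.phi_nonzero[unfolded K] C.R_nonzero[unfolded K]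
  let ?\<psi> = "gauge_cochain \<phi> R"
  let ?b = "(Delta2 klein ?\<psi>, R_of klein ?\<psi>)"
  have "?\<psi> \<in> carrier (unit_maps (pairs klein))"
    using nz unfolding gauge_cochain_def K by (auto simp: unit_group_def)
  moreover have "\<forall>x\<in>carrier klein. \<forall>y\<in>carrier klein. ?\<psi> (\<one>\<^bsub>klein\<^esub>, x) = ?\<psi> (y, \<one>\<^bsub>klein\<^esub>)"
    unfolding gauge_cochain_def K klein_table(2) by simp
  ultimately have b: "?b \<in> B3_ab klein TYPE('k)" unfolding B3_ab_def by blast
  then have bZ: "?b \<in> carrier (Z3_ab klein TYPE('k))" by (rule B.mem_carrier)
  define \<phi>' where "\<phi>' = (\<lambda>i\<in>triples klein. \<phi> i * Delta2 klein ?\<psi> i)"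
  define R' where "R' = (\<lambda>i\<in>pairs klein. R i * R_of klein ?\<psi> i)"
  have cb: "c \<otimes>\<^bsub>Z3_ab klein TYPE('k)\<^esub> ?b = (\<phi>', R')"
    unfolding cR \<phi>'_def R'_def by (simp add: mult_Z3_ab)
  have Z': "(\<phi>', R') \<in> carrier (Z3_ab klein TYPE('k))"
    unfolding cb[symmetric] using c bZ by (rule Z.m_closed)
  have C': "abelian_cocycle klein \<phi>' R'"
    using Z' comm_group_klein unfolding Z3_ab_def
    by (intro abelian_cocycle.intro abelian_cocycle_axioms.intro) simp_all
  have R'1: "R' (x, y) = 1" if xy: "x \<in> carrier klein" "y \<in> carrier klein" for x y
  proof -
    have as: "R (kl_sigma, kl_tau) * R (kl_tau, kl_sigma) = 1"
      "R (kl_sigma, kl_rho) * R (kl_rho, kl_sigma) = 1"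
      "R (kl_rho, kl_tau) * R (kl_tau, kl_rho) = 1"
      by (rule antisym; simp add: K)+
    show ?thesis
      using xy C.R_one_left C.R_one_right diag as nz
      unfolding R'_def R_of_def gauge_cochain_def K klein_table(2)
      by (elim insertE emptyE) (simp_all add: field_simps)
  qed
  have "\<phi>' (kl_sigma, kl_sigma, kl_tau) = 1" "\<phi>' (kl_sigma, kl_tau, kl_tau) = 1"
      "\<phi>' (kl_rho, kl_sigma, kl_tau) = 1"
    unfolding \<phi>'_def Delta2_def gauge_cochain_def K
    by (simp_all add: klein_mult nz K field_simps)
  then have "\<phi>' = trivial_cocycle3 klein"
    using klein_trivial_of_trivial_braiding[OF C' ballI[OF ballI[OF R'1]]] unfolding \<phi>'_def
    by (auto simp: unit_group_def fun_eq_iff restrict_def)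
  moreover have "R' = (\<lambda>i\<in>pairs klein. 1)"
    using R'1 unfolding R'_def by (auto simp: fun_eq_iff restrict_def)
  ultimately have "c \<otimes>\<^bsub>Z3_ab klein TYPE('k)\<^esub> ?b = \<one>\<^bsub>Z3_ab klein TYPE('k)\<^esub>"
    unfolding cb one_Z3_ab by simp
  then have "inv\<^bsub>Z3_ab klein TYPE('k)\<^esub> ?b = c"
    using c bZ by (intro Z.inv_equality)
  then show ?thesis using B.m_inv_closed[OF b] by simp
qed

lemma kernel_trace_klein:
  "kernel (Z3_ab klein TYPE('k::field)) (QF klein TYPE('k)) (trace klein) = B3_ab klein TYPE('k)"
proof
  show "kernel (Z3_ab klein TYPE('k)) (QF klein TYPE('k)) (trace klein) \<subseteq> B3_ab klein TYPE('k)"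
    using klein_trivial_trace_coboundary by (auto simp: kernel_def)
next
  interpret B: subgroup "B3_ab klein TYPE('k)" "Z3_ab klein TYPE('k)"
    by (rule subgroup_B3_ab[OF comm_group_klein])
  have "trace klein b = \<one>\<^bsub>QF klein TYPE('k)\<^esub>" if b: "b \<in> B3_ab klein TYPE('k)" for b
  proof -
    obtain \<psi> where "b = (Delta2 klein \<psi>, R_of klein \<psi>)" "\<psi> \<in> carrier (unit_maps (pairs klein))"
      using b unfolding B3_ab_def by blast
    then show ?thesis
      by (auto simp: trace_def R_of_def QF_def unit_group_def PiE_iff intro!: restrict_ext)
  qed
  then show "B3_ab klein TYPE('k) \<subseteq> kernel (Z3_ab klein TYPE('k)) (QF klein TYPE('k)) (trace klein)"
    using B.subset by (auto simp: kernel_def)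
qed

section \<open>Quadratic functions of the Klein group\<close>

definition klein_fun :: "'k \<Rightarrow> 'k \<Rightarrow> 'k \<Rightarrow> int \<times> int \<Rightarrow> 'k::field" where
  "klein_fun s t r =
     (\<lambda>x\<in>carrier klein. if x = kl_sigma then s else if x = kl_tau then t else if x = kl_rho then r else 1)"

lemma klein_fun_simps [simp]:
  "klein_fun s t r kl_e = 1" "klein_fun s t r kl_sigma = s"
  "klein_fun s t r kl_tau = t" "klein_fun s t r kl_rho = r"
  unfolding klein_fun_def klein_table(1) by simp_all

lemma klein_fun_eq_iff [simp]: "klein_fun s t r = klein_fun s' t' r' \<longleftrightarrow> s = s' \<and> t = t' \<and> r = r'"
  by (metis klein_fun_simps(2-4))

text \<open>
  The relations are the cubical identity at \<open>(\<sigma>, \<sigma>, \<sigma>)\<close>, \<open>(\<tau>, \<tau>, \<tau>)\<close> and \<open>(\<sigma>, \<sigma>, \<tau>)\<close>. For the converse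
  \<open>r\<close> is written as \<open>stu\<close> with \<open>u\<^sup>2 = 1\<close>, so that all remaining instances become identities between
  monomials in \<open>s, t, u\<close>.
\<close>

lemma mem_QF_klein_iff:
  "Q \<in> carrier (QF klein TYPE('k::field)) \<longleftrightarrow>
     (\<exists>s t r. Q = klein_fun s t r \<and> s ^ 4 = 1 \<and> t ^ 4 = 1 \<and> r\<^sup>2 = s\<^sup>2 * t\<^sup>2)"
  (is "?L \<longleftrightarrow> ?R")
proof
  assume ?L
  then have nz: "\<And>x. x \<in> carrier klein \<Longrightarrow> Q x \<noteq> 0" and ext: "Q \<in> extensional (carrier klein)"
    and cub: "\<And>x y z. x \<in> carrier klein \<Longrightarrow> y \<in> carrier klein \<Longrightarrow> z \<in> carrier klein \<Longrightarrow>
       Q (x \<otimes>\<^bsub>klein\<^esub> y \<otimes>\<^bsub>klein\<^esub> z) * Q x * Q y * Q z =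
       Q (x \<otimes>\<^bsub>klein\<^esub> y) * Q (x \<otimes>\<^bsub>klein\<^esub> z) * Q (y \<otimes>\<^bsub>klein\<^esub> z)"
    by (auto simp: QF_def unit_group_def PiE_iff)
  note K = klein_table(1)
  note nz = nz[unfolded K] and cub = cub[unfolded K]
  have e: "Q kl_e = 1" using cub[of kl_e kl_e kl_e] nz[of kl_e] by (simp add: klein_mult)
  have "Q kl_sigma ^ 4 = 1" "Q kl_tau ^ 4 = 1"
    using cub[of kl_sigma kl_sigma kl_sigma] cub[of kl_tau kl_tau kl_tau]
    by (simp_all add: klein_mult e power4_eq_xxxx)
  moreover have "(Q kl_rho)\<^sup>2 = (Q kl_sigma)\<^sup>2 * (Q kl_tau)\<^sup>2"
    using cub[of kl_sigma kl_sigma kl_tau] by (simp add: klein_mult e power2_eq_square mult_ac)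
  moreover have "Q = klein_fun (Q kl_sigma) (Q kl_tau) (Q kl_rho)"
  proof (rule extensionalityI[OF ext])
    fix x assume "x \<in> carrier klein"
    then show "Q x = klein_fun (Q kl_sigma) (Q kl_tau) (Q kl_rho) x"
      using e unfolding K by auto
  qed (simp add: klein_fun_def)
  ultimately show ?R by blast
next
  assume ?R
  then obtain s t r where Q: "Q = klein_fun s t r" "s ^ 4 = 1" "t ^ 4 = 1" "r\<^sup>2 = s\<^sup>2 * t\<^sup>2" by blast
  have nz: "s \<noteq> 0" "t \<noteq> 0" using Q(2,3) by auto
  define u where "u = r / (s * t)"
  have u2: "u * u = 1" using Q(4) nz unfolding u_def by (simp add: power2_eq_square)
  have r: "r = s * t * u" using nz unfolding u_def by simp
  have nzu: "u \<noteq> 0" using u2 by auto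
  have q: "s * (s * (s * s)) = 1" "t * (t * (t * t)) = 1"
      "s * (s * (s * (s * y))) = y" "t * (t * (t * (t * y))) = y" "u * (u * y) = y" for y
    using Q(2,3) u2 by (simp_all add: power4_eq_xxxx flip: mult.assoc)
  note K = klein_table(1)
  have "Q x \<noteq> 0" if "x \<in> carrier klein" for x
    using that nz nzu r unfolding Q(1) K by auto
  moreover have "Q \<in> extensional (carrier klein)" unfolding Q(1) klein_fun_def by simp
  moreover have "inv\<^bsub>klein\<^esub> x = x" if "x \<in> carrier klein" for x
    using that unfolding K by (auto simp: carrier_integer_mod_group)
  moreover have "Q (x \<otimes>\<^bsub>klein\<^esub> y \<otimes>\<^bsub>klein\<^esub> z) * Q x * Q y * Q z =
             Q (x \<otimes>\<^bsub>klein\<^esub> y) * Q (x \<otimes>\<^bsub>klein\<^esub> z) * Q (y \<otimes>\<^bsub>klein\<^esub> z)"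
    if "x \<in> carrier klein" "y \<in> carrier klein" "z \<in> carrier klein" for x y z
    using that unfolding K Q(1)
    by (elim insertE emptyE; simp add: klein_mult r q u2 mult_ac)
  ultimately show ?L by (auto simp: QF_def unit_group_def PiE_iff)
qed

text \<open>
  For a quadratic function these are the elements with value a primitive fourth root of unity. In
  characteristic other than \<open>2\<close> this is the only set \<open>X\<close> of involutions for which it can be the trace of
  an abelian cocycle over \<open>\<phi>\<^sub>X\<close>.
\<close>

definition quartic_support :: "(int \<times> int \<Rightarrow> 'k::field) \<Rightarrow> (int \<times> int) set" where
  "quartic_support Q = {x \<in> carrier klein. (Q x)\<^sup>2 \<noteq> 1}"

lemma sgn_of_quartic_support:
  assumes "Q \<in> carrier (QF klein TYPE('k::field))" "x \<in> carrier klein"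
  shows "sgn_of (quartic_support Q) x = (Q x)\<^sup>2"
proof -
  obtain s t r where Q: "Q = klein_fun s t r" "s ^ 4 = 1" "t ^ 4 = 1" "r\<^sup>2 = s\<^sup>2 * t\<^sup>2"
    using assms(1) unfolding mem_QF_klein_iff by blast
  have "r ^ 4 = (r\<^sup>2)\<^sup>2" by simp
  also have "\<dots> = 1" using Q(2,3) unfolding Q(4) by (simp add: power_mult_distrib)
  finally have "((Q x)\<^sup>2)\<^sup>2 = 1"
    using assms(2) Q unfolding klein_table(1) by (auto simp: power_mult_distrib)
  then have "(Q x)\<^sup>2 = 1 \<or> (Q x)\<^sup>2 = -1"
    using power2_eq_1_iff[of "(Q x)\<^sup>2"] by blast
  then show ?thesis using assms(2) by (auto simp: sgn_of_def quartic_support_def)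
qed

lemma sgn_of_quartic_support_prod:
  assumes "Q \<in> carrier (QF klein TYPE('k::field))"
  shows "sgn_of (quartic_support Q) kl_sigma * sgn_of (quartic_support Q) kl_tau
    * sgn_of (quartic_support Q) kl_rho = (1::'k)"
proof -
  obtain s t r where Q: "Q = klein_fun s t r" "s ^ 4 = 1" "t ^ 4 = 1" "r\<^sup>2 = s\<^sup>2 * t\<^sup>2"
    using assms unfolding mem_QF_klein_iff by blast
  have "s\<^sup>2 * t\<^sup>2 * (s\<^sup>2 * t\<^sup>2) = s ^ 4 * t ^ 4"
    by (simp add: power2_eq_square power4_eq_xxxx mult_ac)
  then show ?thesis
    using sgn_of_quartic_support[OF assms] Q by (simp add: klein_table(1) del: carrier_DirProd)
qed

text \<open>
  When the product \<open>p\<close> of the three signs is \<open>1\<close>, the table of \<open>\<phi>\<^sub>X\<close> collapses to a product of two pulled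
  back cocycles of \<open>C\<^sub>2\<close>, one for each coordinate.
\<close>

lemma phi_of_trilinear:
  assumes p: "sgn_of X kl_sigma * sgn_of X kl_tau * sgn_of X kl_rho = (1::'k::field)"
    and "(a, b) \<in> carrier klein" "(c, d) \<in> carrier klein" "(f, g) \<in> carrier klein"
  shows "phi_of X ((a, b), (c, d), (f, g))
    = (sgn_of X kl_sigma powi (a * c * f) * sgn_of X kl_tau powi (b * d * g) :: 'k)"
proof -
  have "sgn_of X kl_sigma * sgn_of X kl_tau = (sgn_of X kl_rho :: 'k)"
    using p by (auto simp: sgn_of_def split: if_splits)
  then show ?thesis
    using assms unfolding klein_table(1)
    by (elim insertE emptyE)
       (simp_all add: phi_of_def klein_table(1) Let_def mset2_eq mset3_eq p del: carrier_DirProd)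
qed

lemma phi_of_empty: "(phi_of {} :: _ \<Rightarrow> 'k::field) = trivial_cocycle3 klein"
proof -
  have "phi_of {} x = (1::'k)" if "x \<in> triples klein" for x
  proof -
    obtain a b c d f g where x: "x = ((a, b), (c, d), (f, g))" by (metis prod.exhaust)
    show ?thesis using that unfolding x
      by (subst phi_of_trilinear) (auto simp: sgn_of_def)
  qed
  then show ?thesis
    by (intro extensionalityI[of _ "triples klein"]) (simp_all add: phi_of_def unit_group_def)
qed

text \<open>
  The bicharacter of \<open>\<int>\<^sup>2\<close> with diagonal values \<open>Q(\<sigma>), Q(\<tau>), Q(\<rho>)\<close> at \<open>(1, 0), (0, 1), (1, 1)\<close>, evaluated at
  representatives in \<open>{0, 1}\<close>. The off-diagonal factor is put entirely on the exponent \<open>a d\<close>.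
\<close>

definition klein_braiding :: "(int \<times> int \<Rightarrow> 'k::field) \<Rightarrow> (int \<times> int) \<times> (int \<times> int) \<Rightarrow> 'k" where
  "klein_braiding Q =
     restrict
       (\<lambda>((a, b), (c, d)). Q kl_sigma powi (a * c) * Q kl_tau powi (b * d)
          * (Q kl_rho / (Q kl_sigma * Q kl_tau)) powi (a * d))
       (pairs klein)"

text \<open>
  Reducing an exponent \<open>a + c\<close> modulo \<open>2\<close> changes \<open>w\<^bsup>(a + c) f\<^esup>\<close> by \<open>w\<^bsup>-2 a c f\<^esup>\<close>, which for \<open>w\<^sup>4 = 1\<close> is
  \<open>(w\<^sup>2)\<^bsup>a c f\<^esup>\<close>: this carry is the associator, and both hexagons follow by comparing exponents.
\<close>

lemma abelian_cocycle3_klein_braiding: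
  assumes QF: "Q \<in> carrier (QF klein TYPE('k::field))"
  shows "abelian_cocycle3 klein (phi_of (quartic_support Q)) (klein_braiding Q)"
    and "trace klein (phi_of (quartic_support Q), klein_braiding Q) = Q"
proof -
  obtain s t r where Q: "Q = klein_fun s t r" "s ^ 4 = 1" "t ^ 4 = 1" "r\<^sup>2 = s\<^sup>2 * t\<^sup>2"
    using QF unfolding mem_QF_klein_iff by blast
  define u where "u = r / (s * t)"
  have nz: "s \<noteq> 0" "t \<noteq> 0" using Q by auto
  have u2: "u * u = 1"
    using Q(4) nz unfolding u_def by (simp add: power2_eq_square)
  then have nzu: "u \<noteq> 0" by auto
  have r: "r = s * t * u" using nz unfolding u_def by simp
  note K = klein_table(1)
  have Qv: "Q kl_e = 1" "Q kl_sigma = s" "Q kl_tau = t" "Q kl_rho = r" by (simp_all add: Q(1))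
  have B: "klein_braiding Q ((a, b), (c, d)) = s powi (a * c) * t powi (b * d) * u powi (a * d)"
    if "(a, b) \<in> carrier klein" "(c, d) \<in> carrier klein" for a b c d
    using that unfolding klein_braiding_def u_def Q(1) by simp
  have P: "phi_of (quartic_support Q) ((a, b), (c, d), (f, g))
      = (s * s) powi (a * c * f) * (t * t) powi (b * d * g)"
    if "(a, b) \<in> carrier klein" "(c, d) \<in> carrier klein" "(f, g) \<in> carrier klein" for a b c d f g
    using phi_of_trilinear[OF sgn_of_quartic_support_prod[OF QF] that]
      sgn_of_quartic_support[OF QF, of kl_sigma] sgn_of_quartic_support[OF QF, of kl_tau]
    unfolding Q(1) by (simp add: power2_eq_square K del: carrier_DirProd)
  have sq: "(s * s) powi e * ((s * s) powi e * y) = y" "(t * t) powi e * ((t * t) powi e * y) = y"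
    "(s * s) powi e * (s * s) powi e = 1" "(t * t) powi e * (t * t) powi e = 1" for e y
    using Q(2,3)
    by (simp_all add: power4_eq_xxxx flip: mult.assoc power_int_mult_distrib)
  have carry: "w powi ((a + c) mod 2 * f) = w powi (a * f) * w powi (c * f) * (w * w) powi (a * c * f)"
    "w powi (f * ((a + c) mod 2)) = w powi (f * a) * w powi (f * c) * (w * w) powi (f * a * c)"
    if "w ^ 4 = 1" "a \<in> {0, 1}" "c \<in> {0, 1}" "f \<in> {0, 1}" for w :: 'k and a c f :: int
    using that by (auto simp: power4_eq_xxxx mult.assoc)
  have carry_u: "u powi ((a + c) mod 2 * f) = u powi (a * f) * u powi (c * f)"
    "u powi (f * ((a + c) mod 2)) = u powi (f * a) * u powi (f * c)"
    if "a \<in> {0, 1}" "c \<in> {0, 1}" "f \<in> {0, 1}" for a c f :: int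
    using that u2 by auto
  have "klein_braiding Q \<in> carrier (unit_maps (pairs klein))"
    using nz nzu unfolding klein_braiding_def Q(1) u_def by (auto simp: unit_group_def)
  moreover have "klein_braiding Q (x \<otimes>\<^bsub>klein\<^esub> y, z) * phi_of (quartic_support Q) (x, z, y) =
          phi_of (quartic_support Q) (x, y, z) * klein_braiding Q (x, z)
            * phi_of (quartic_support Q) (z, x, y) * klein_braiding Q (y, z)"
    "phi_of (quartic_support Q) (x, y, z) * klein_braiding Q (x, y \<otimes>\<^bsub>klein\<^esub> z)
          * phi_of (quartic_support Q) (y, z, x) =
          klein_braiding Q (x, y) * phi_of (quartic_support Q) (y, x, z) * klein_braiding Q (x, z)"
    if "x \<in> carrier klein" "y \<in> carrier klein" "z \<in> carrier klein" for x y z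
  proof -
    obtain a b c d f g where e: "x = (a, b)" "y = (c, d)" "z = (f, g)" by (metis prod.exhaust)
    have r: "a \<in> {0, 1}" "b \<in> {0, 1}" "c \<in> {0, 1}" "d \<in> {0, 1}" "f \<in> {0, 1}" "g \<in> {0, 1}"
      using that unfolding e K by auto
    have m: "((a + c) mod 2, (b + d) mod 2) \<in> carrier klein" "((c + f) mod 2, (d + g) mod 2) \<in> carrier klein"
      by (simp_all add: carrier_integer_mod_group)
    note that[unfolded e]
    note BP = B[OF this(1,2)] B[OF this(1,3)] B[OF this(2,3)] B[OF m(1) this(3)] B[OF this(1) m(2)]
      P[OF this(1,2,3)] P[OF this(1,3,2)] P[OF this(3,1,2)] P[OF this(2,3,1)] P[OF this(2,1,3)]
    note cs = carry[OF Q(2)] carry[OF Q(3)] carry_u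
    show "klein_braiding Q (x \<otimes>\<^bsub>klein\<^esub> y, z) * phi_of (quartic_support Q) (x, z, y) =
          phi_of (quartic_support Q) (x, y, z) * klein_braiding Q (x, z)
            * phi_of (quartic_support Q) (z, x, y) * klein_braiding Q (y, z)"
      unfolding e klein_mult BP cs[OF r(1,3,5)] cs[OF r(2,4,6)] cs[OF r(1,3,6)]
      by (simp add: mult_ac sq)
    show "phi_of (quartic_support Q) (x, y, z) * klein_braiding Q (x, y \<otimes>\<^bsub>klein\<^esub> z)
          * phi_of (quartic_support Q) (y, z, x) =
          klein_braiding Q (x, y) * phi_of (quartic_support Q) (y, x, z) * klein_braiding Q (x, z)"
      unfolding e klein_mult BP cs[OF r(3,5,1)] cs[OF r(4,6,2)] cs[OF r(4,6,1)]
      by (simp add: mult_ac sq)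
  qed
  ultimately show "abelian_cocycle3 klein (phi_of (quartic_support Q)) (klein_braiding Q)"
    using cocycle_phi_of unfolding abelian_cocycle3_def by blast
  show "trace klein (phi_of (quartic_support Q), klein_braiding Q) = Q"
  proof (rule extensionalityI)
    show "trace klein (phi_of (quartic_support Q), klein_braiding Q) \<in> extensional (carrier klein)"
      by (simp add: trace_def)
    show "Q \<in> extensional (carrier klein)" by (simp add: Q(1) klein_fun_def)
    fix x assume "x \<in> carrier klein"
    then show "trace klein (phi_of (quartic_support Q), klein_braiding Q) x = Q x"
      using Qv unfolding trace_def K
      by (elim insertE emptyE) (simp_all add: B[unfolded K] r)
  qed
qed

section \<open>Cohomology classes and quadratic functions\<close>

text \<open>
  A class has the trace of any of its members; \<open>the_elem\<close> of the image is how the quotient map of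
  the first isomorphism theorem is written.
\<close>

definition class_trace :: "('g, 'm) monoid_scheme \<Rightarrow> ('g, 'k::field) abelian_cochain set \<Rightarrow> 'g \<Rightarrow> 'k" where
  "class_trace G c = the_elem (trace G ` c)"

lemma class_trace_eq:
  assumes c: "c \<in> carrier (H3_ab klein TYPE('k::field))" and z: "z \<in> c"
  shows "class_trace klein c = trace klein z"
proof -
  interpret T: group_hom "Z3_ab klein TYPE('k)" "QF klein TYPE('k)" "trace klein"
    by (rule group_hom_trace[OF comm_group_klein])
  obtain y where y: "y \<in> carrier (Z3_ab klein TYPE('k))" "c = B3_ab klein TYPE('k) #>\<^bsub>Z3_ab klein TYPE('k)\<^esub> y"
    using c unfolding H3_ab_def FactGroup_def RCOSETS_def by auto
  have "trace klein w = trace klein y" if w: "w \<in> c" for w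
  proof -
    obtain b where b: "b \<in> B3_ab klein TYPE('k)" "w = b \<otimes>\<^bsub>Z3_ab klein TYPE('k)\<^esub> y"
      using w unfolding y(2) r_coset_def by blast
    have "b \<in> carrier (Z3_ab klein TYPE('k))" "trace klein b = \<one>\<^bsub>QF klein TYPE('k)\<^esub>"
      using b(1) unfolding kernel_trace_klein[symmetric] kernel_def by auto
    then show ?thesis unfolding b(2) using y(1) by (subst T.hom_mult) auto
  qed
  then show ?thesis
    unfolding class_trace_def using z by (intro the_elem_image_unique) auto
qed

lemma class_trace_iso:
  "class_trace klein \<in> iso (H3_ab klein TYPE('k::field)) (QF klein TYPE('k))"
proof -
  interpret T: group_hom "Z3_ab klein TYPE('k)" "QF klein TYPE('k)" "trace klein"
    by (rule group_hom_trace[OF comm_group_klein])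
  have "trace klein ` carrier (Z3_ab klein TYPE('k)) = carrier (QF klein TYPE('k))"
  proof
    show "carrier (QF klein TYPE('k)) \<subseteq> trace klein ` carrier (Z3_ab klein TYPE('k))"
    proof
      fix Q assume Q: "Q \<in> carrier (QF klein TYPE('k))"
      show "Q \<in> trace klein ` carrier (Z3_ab klein TYPE('k))"
        using abelian_cocycle3_klein_braiding[OF Q]
        by (intro image_eqI[of _ _ "(phi_of (quartic_support Q), klein_braiding Q)"])
           (simp_all add: Z3_ab_def)
    qed
  qed auto
  from T.FactGroup_iso_set[OF this] show ?thesis
    unfolding kernel_trace_klein H3_ab_def class_trace_def .
qed

text \<open>
  An abelian cocycle over \<open>\<phi>\<^sub>X\<close> satisfies \<open>R(x, x)\<^sup>2 = \<phi>\<^sub>X(x, x, x) = \<epsilon>\<^sub>x\<close>, so its trace determines \<open>X\<close>.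
  In the other direction the explicit cocycle built from the trace lies over \<open>\<phi>\<^sub>X\<close> and, having the
  same trace, belongs to the given class.
\<close>

lemma klein_class_over_iff:
  assumes char: "(1::'k::field) \<noteq> -1" and X: "X \<subseteq> {kl_sigma, kl_tau, kl_rho}"
    and c: "c \<in> carrier (H3_ab klein TYPE('k))"
  shows "c \<in> classes_over klein (phi_of X :: _ \<Rightarrow> 'k) \<longleftrightarrow> quartic_support (class_trace klein c) = X"
proof -
  interpret Z: comm_group "Z3_ab klein TYPE('k)" by (rule comm_group_Z3_ab[OF comm_group_klein])
  have sub: "subgroup (B3_ab klein TYPE('k)) (Z3_ab klein TYPE('k))"
    by (rule subgroup_B3_ab[OF comm_group_klein])
  show ?thesis
  proof
    assume "c \<in> classes_over klein (phi_of X :: _ \<Rightarrow> 'k)"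
    then obtain R where R: "(phi_of X, R) \<in> c" unfolding classes_over_def by blast
    have "c \<subseteq> carrier (Z3_ab klein TYPE('k))"
      using c Z.rcosets_part_G[OF sub] unfolding H3_ab_def FactGroup_def by auto
    then interpret abelian_cocycle klein "phi_of X" R
      using R comm_group_klein
      by (intro abelian_cocycle.intro abelian_cocycle_axioms.intro) (auto simp: Z3_ab_def)
    have "(class_trace klein c x)\<^sup>2 = sgn_of X x" if x: "x \<in> carrier klein" for x
    proof -
      have "(class_trace klein c x)\<^sup>2 = (R (x, x))\<^sup>2"
        unfolding class_trace_eq[OF c R] using x by (simp add: trace_def)
      also have "\<dots> = phi_of X (x, x, x)"
        using x by (intro R_square_involution) (auto simp: klein_table(1,2) klein_mult simp del: carrier_DirProd one_DirProd mult_DirProd)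
      also have "\<dots> = sgn_of X x"
        using x X unfolding phi_of_def by (auto simp: Let_def sgn_of_def)
      finally show ?thesis .
    qed
    moreover have "X \<subseteq> carrier klein" using X unfolding klein_table(1) by auto
    ultimately show "quartic_support (class_trace klein c) = X"
      using char unfolding quartic_support_def by (auto simp: sgn_of_def split: if_splits)
  next
    assume X': "quartic_support (class_trace klein c) = X"
    let ?Q = "class_trace klein c"
    let ?z = "(phi_of X, klein_braiding ?Q)"
    let ?d = "B3_ab klein TYPE('k) #>\<^bsub>Z3_ab klein TYPE('k)\<^esub> ?z"
    have Q: "?Q \<in> carrier (QF klein TYPE('k))"
      using class_trace_iso c by (auto simp: iso_def bij_betw_def)
    have z: "?z \<in> carrier (Z3_ab klein TYPE('k))"
      using abelian_cocycle3_klein_braiding(1)[OF Q] unfolding X' by (simp add: Z3_ab_def)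
    have zd: "?z \<in> ?d" using z sub by (rule Z.rcos_self)
    have d: "?d \<in> carrier (H3_ab klein TYPE('k))"
      using z unfolding H3_ab_def FactGroup_def RCOSETS_def by auto
    have "class_trace klein ?d = ?Q"
      unfolding class_trace_eq[OF d zd]
      using abelian_cocycle3_klein_braiding(2)[OF Q] unfolding X' .
    then have "?d = c"
      using class_trace_iso c d unfolding iso_def bij_betw_def by (auto dest: inj_onD)
    then show "c \<in> classes_over klein (phi_of X :: _ \<Rightarrow> 'k)"
      using c zd unfolding classes_over_def by auto
  qed
qed

section \<open>Counting\<close>

text \<open>
  The trace identifies these classes with the triples of square roots of the three signs, two choices
  for each sign.
\<close>

lemma card_classes_over_phi_of:
  assumes char: "(1::'k::field) \<noteq> -1" and X: "X \<subseteq> {kl_sigma, kl_tau, kl_rho}"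
    and p: "sgn_of X kl_sigma * sgn_of X kl_tau * sgn_of X kl_rho = (1::'k)"
    and i: "\<And>x. \<exists>w::'k. w\<^sup>2 = sgn_of X x"
  shows "card (classes_over klein (phi_of X :: _ \<Rightarrow> 'k)) = 8"
proof -
  let ?A = "\<lambda>x. {w::'k. w\<^sup>2 = sgn_of X x}"
  have two: "card (?A x) = 2" for x
  proof -
    obtain w :: 'k where w: "w\<^sup>2 = sgn_of X x" using i by blast
    then have "w \<noteq> 0" by (auto simp: sgn_of_def split: if_splits)
    then have "w \<noteq> - w" using char by (metis mult_cancel_left1 mult_minus_right)
    moreover have "?A x = {w, - w}" unfolding w[symmetric] by (auto simp: power2_eq_iff)
    ultimately show ?thesis by simp
  qed
  have "{Q \<in> carrier (QF klein TYPE('k)). quartic_support Q = X}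
      = (\<lambda>(s, t, r). klein_fun s t r) ` (?A kl_sigma \<times> ?A kl_tau \<times> ?A kl_rho)"
    (is "?L = ?I")
  proof
    show "?L \<subseteq> ?I"
    proof
      fix Q assume "Q \<in> ?L"
      then have Q: "Q \<in> carrier (QF klein TYPE('k))" "quartic_support Q = X" by auto
      then obtain s t r where str: "Q = klein_fun s t r" unfolding mem_QF_klein_iff by blast
      show "Q \<in> ?I"
        using sgn_of_quartic_support[OF Q(1)] Q(2) str
        by (intro image_eqI[of _ _ "(s, t, r)"]) (auto simp: klein_table(1) simp del: carrier_DirProd)
    qed
  next
    show "?I \<subseteq> ?L"
    proof (clarify)
      fix s t r :: 'k
      assume a: "s\<^sup>2 = sgn_of X kl_sigma" "t\<^sup>2 = sgn_of X kl_tau" "r\<^sup>2 = sgn_of X kl_rho"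
      have sq: "(sgn_of X x)\<^sup>2 = (1::'k)" for x by (simp add: sgn_of_def)
      have "(s\<^sup>2)\<^sup>2 = 1" "(t\<^sup>2)\<^sup>2 = 1" unfolding a by (rule sq)+
      moreover have "r\<^sup>2 = s\<^sup>2 * t\<^sup>2"
        using p unfolding a by (auto simp: sgn_of_def split: if_splits)
      ultimately have "klein_fun s t r \<in> carrier (QF klein TYPE('k))"
        unfolding mem_QF_klein_iff by auto
      moreover have "quartic_support (klein_fun s t r) = X"
      proof -
        have e: "kl_e \<notin> X" using X by auto
        have square: "(klein_fun s t r x)\<^sup>2 = sgn_of X x" if "x \<in> carrier klein" for x
          using that a e unfolding klein_table(1) by (elim insertE emptyE) (simp_all add: sgn_of_def)
        have sgn: "sgn_of X x \<noteq> (1::'k) \<longleftrightarrow> x \<in> X" for x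
          using char[symmetric] by (simp add: sgn_of_def)
        have "quartic_support (klein_fun s t r) = {x \<in> carrier klein. x \<in> X}"
          unfolding quartic_support_def using square sgn by (intro Collect_cong) metis
        also have "\<dots> = X" using X unfolding klein_table(1) by auto
        finally show ?thesis .
      qed
      ultimately show "klein_fun s t r \<in> carrier (QF klein TYPE('k)) \<and> quartic_support (klein_fun s t r) = X"
        by blast
    qed
  qed
  moreover have "inj_on (\<lambda>(s, t, r). klein_fun s t r) (?A kl_sigma \<times> ?A kl_tau \<times> ?A kl_rho)"
    by (auto simp: inj_on_def)
  ultimately have "card {Q \<in> carrier (QF klein TYPE('k)). quartic_support Q = X} = 8"
    by (simp add: card_image card_cartesian_product two)
  moreover have "bij_betw (class_trace klein) (classes_over klein (phi_of X :: _ \<Rightarrow> 'k))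
      {Q \<in> carrier (QF klein TYPE('k)). quartic_support Q = X}"
  proof (rule bij_betw_subset[of _ "carrier (H3_ab klein TYPE('k))" "carrier (QF klein TYPE('k))"])
    show bij: "bij_betw (class_trace klein) (carrier (H3_ab klein TYPE('k))) (carrier (QF klein TYPE('k)))"
      using class_trace_iso by (auto simp: iso_def)
    show "classes_over klein (phi_of X :: _ \<Rightarrow> 'k) \<subseteq> carrier (H3_ab klein TYPE('k))"
      by (auto simp: classes_over_def)
    have eq: "classes_over klein (phi_of X :: _ \<Rightarrow> 'k)
        = {c \<in> carrier (H3_ab klein TYPE('k)). quartic_support (class_trace klein c) = X}"
      using klein_class_over_iff[OF char X] by (auto simp: classes_over_def)
    show "class_trace klein ` classes_over klein (phi_of X :: _ \<Rightarrow> 'k)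
        = {Q \<in> carrier (QF klein TYPE('k)). quartic_support Q = X}"
      unfolding eq bij_betw_imp_surj_on[OF bij, symmetric] by blast
  qed
  ultimately show ?thesis by (simp add: bij_betw_same_card)
qed

text \<open>
  The parity condition that leaves only the empty set and the three two-element sets.
\<close>

lemma sgn_of_prod_iff:
  assumes char: "(1::'k::field) \<noteq> -1" and X: "X \<subseteq> {kl_sigma, kl_tau, kl_rho}"
  shows "sgn_of X kl_sigma * sgn_of X kl_tau * sgn_of X kl_rho = (1::'k) \<longleftrightarrow> X = {} \<or> card X = 2"
proof -
  have "X = (if kl_sigma \<in> X then {kl_sigma} else {}) \<union> (if kl_tau \<in> X then {kl_tau} else {})
      \<union> (if kl_rho \<in> X then {kl_rho} else {})" (is "_ = ?Y")
    using X by auto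
  then have "X = {} \<longleftrightarrow> ?Y = {}" "card X = card ?Y" by simp_all
  then show ?thesis using char[symmetric]
    by (cases "kl_sigma \<in> X"; cases "kl_tau \<in> X"; cases "kl_rho \<in> X") (simp_all add: sgn_of_def)
qed

lemma powi_mod_order:
  assumes "w ^ n = (1::'k::field)" "0 < n"
  shows "w powi (a mod int n) = w powi a"
proof -
  have "w \<noteq> 0" using assms by (auto simp: zero_power)
  have "w powi a = w powi (int n * (a div int n) + a mod int n)" by simp
  also have "\<dots> = w powi (a mod int n)"
    using assms(1) \<open>w \<noteq> 0\<close> by (subst power_int_add) (simp_all add: power_int_mult)
  finally show ?thesis ..
qed

text \<open>
  The isomorphism sends exponents \<open>(a, b, c)\<close> to the function with values \<open>w\<^sup>a\<close>, \<open>w\<^sup>b\<close> and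
  \<open>w\<^sup>a w\<^sup>b (-1)\<^sup>c\<close>. It is used for \<open>w = -1\<close> and for \<open>w\<close> a primitive fourth root of unity.
\<close>

lemma QF_klein_iso:
  assumes char: "(1::'k::field) \<noteq> -1"
    and w: "primitive_root_of_unity n (w::'k)" and w4: "w ^ 4 = 1"
    and all: "\<And>x::'k. x ^ 4 = 1 \<Longrightarrow> \<exists>m<n. x = w ^ m"
  shows "QF klein TYPE('k) \<cong> integer_mod_group n \<times>\<times> integer_mod_group n \<times>\<times> integer_mod_group 2"
    and "card (carrier (QF klein TYPE('k))) = 2 * n\<^sup>2"
proof -
  let ?Z = "integer_mod_group n \<times>\<times> integer_mod_group n \<times>\<times> integer_mod_group 2"
  have n: "0 < n" "w ^ n = 1" using w by (auto simp: primitive_root_of_unity_def)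
  have w0: "w \<noteq> 0" using w4 by auto
  have carrier_Z: "carrier ?Z = {0..<int n} \<times> {0..<int n} \<times> {0..<2}"
    using n by (simp add: carrier_integer_mod_group)
  define f where "f = (\<lambda>(a, b, c). klein_fun (w powi a) (w powi b) (w powi a * w powi b * (-1) powi c))"
  have inj: "a = b" if "w powi a = w powi b" "a \<in> {0..<int n}" "b \<in> {0..<int n}" for a b
  proof -
    have le: "a = b" if "w powi a = w powi b" "a \<in> {0..<int n}" "b \<in> {0..<int n}" "a \<le> b" for a b
    proof (rule ccontr)
      assume "a \<noteq> b"
      with that have "0 < nat (b - a)" "nat (b - a) < n" by auto
      moreover have "w powi (b - a) = 1" using w0 that(1) by (subst power_int_diff) auto
      then have "w ^ nat (b - a) = 1" using that by (simp add: power_int_def)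
      ultimately show False using w by (auto simp: primitive_root_of_unity_def)
    qed
    show ?thesis by (cases "a \<le> b") (use le[of a b] le[of b a] that in auto)
  qed
  have "f \<in> hom ?Z (QF klein TYPE('k))"
  proof (rule homI)
    fix x assume "x \<in> carrier ?Z"
    have pw: "(w powi a) ^ 4 = 1" for a
      by (metis power_int_mult power_int_1_left power_int_of_nat power_int_power' mult.commute w4)
    have m: "((-1) powi a)\<^sup>2 = (1::'k)" for a by (cases "even a") (simp_all add: power_int_minus_left)
    show "f x \<in> carrier (QF klein TYPE('k))"
      unfolding f_def mem_QF_klein_iff by (cases x) (auto simp: pw m power_mult_distrib)
  next
    fix x y assume "x \<in> carrier ?Z" "y \<in> carrier ?Z"
    have m2: "(-1) powi (a mod 2) = ((-1) powi a :: 'k)" for a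
      using powi_mod_order[of "-1::'k" 2 a] by simp
    have mul: "klein_fun s t r \<otimes>\<^bsub>QF klein TYPE('k)\<^esub> klein_fun s' t' r' = klein_fun (s * s') (t * t') (r * r')"
      for s t r s' t' r' :: 'k
      unfolding QF_def klein_fun_def by (auto simp: unit_group_def intro!: restrict_ext)
    show "f (x \<otimes>\<^bsub>?Z\<^esub> y) = f x \<otimes>\<^bsub>QF klein TYPE('k)\<^esub> f y"
      by (cases x; cases y)
         (simp add: f_def mul powi_mod_order[OF n(2,1)] m2 power_int_add w0 mult_ac)
  qed
  moreover have "bij_betw f (carrier ?Z) (carrier (QF klein TYPE('k)))"
  proof -
    have "inj_on f (carrier ?Z)"
    proof (rule inj_onI)
      fix x y assume xy: "x \<in> carrier ?Z" "y \<in> carrier ?Z" "f x = f y"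
      obtain a b c a' b' c' where e: "x = (a, b, c)" "y = (a', b', c')" by (metis prod.exhaust)
      have r: "a \<in> {0..<int n}" "a' \<in> {0..<int n}" "b \<in> {0..<int n}" "b' \<in> {0..<int n}"
        "c \<in> {0, 1}" "c' \<in> {0, 1}"
        using xy(1,2) unfolding e carrier_Z by auto
      have w_eq: "w powi a = w powi a'" "w powi b = w powi b'"
        using xy(3) unfolding e f_def by simp_all
      moreover have "(-1) powi c = ((-1) powi c' :: 'k)"
        using xy(3) w0 unfolding e f_def by (simp add: w_eq)
      ultimately
show "x = y" unfolding e using inj r char char[symmetric] by auto
    qed
    moreover have "f ` carrier ?Z = carrier (QF klein TYPE('k))"
    proof
      show "f ` carrier ?Z \<subseteq> carrier (QF klein TYPE('k))"
        using \<open>f \<in> hom _ _\<close> by (auto simp: hom_def)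
      show "carrier (QF klein TYPE('k)) \<subseteq> f ` carrier ?Z"
      proof
        fix Q assume "Q \<in> carrier (QF klein TYPE('k))"
        then obtain s t r where Q: "Q = klein_fun s t r" "s ^ 4 = 1" "t ^ 4 = 1" "r\<^sup>2 = s\<^sup>2 * t\<^sup>2"
          unfolding mem_QF_klein_iff by blast
        obtain a b where ab: "a < n" "s = w ^ a" "b < n" "t = w ^ b" using all Q(2,3) by metis
        have "r\<^sup>2 = (s * t)\<^sup>2" using Q(4) by (simp add: power_mult_distrib)
        then have "r = s * t \<or> r = - (s * t)" by (simp add: power2_eq_iff)
        then obtain c :: int where c: "c \<in> {0, 1}" "r = s * t * (-1) powi c"
          by (metis insertI1 insertI2 power_int_0_right power_int_1_right mult.right_neutral mult_minus1_right)
        show "Q \<in> f ` carrier ?Z"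
          using ab c Q(1) by (intro image_eqI[of _ _ "(int a, int b, c)"]) (auto simp: f_def carrier_Z simp del: carrier_DirProd)
      qed
    qed
    ultimately show ?thesis by (simp add: bij_betw_def)
  qed
  ultimately have iso: "f \<in> iso ?Z (QF klein TYPE('k))" by (simp add: iso_def)
  have "group ?Z" by (intro DirProd_group group_integer_mod_group)
  then show "QF klein TYPE('k) \<cong> ?Z" using iso group.iso_sym unfolding is_iso_def by blast
  have "card (carrier (QF klein TYPE('k))) = card (carrier ?Z)"
    using iso bij_betw_same_card unfolding iso_def by fastforce
  also have "\<dots> = 2 * n\<^sup>2"
    unfolding carrier_Z by (simp add: card_cartesian_product power2_eq_square)
  finally show "card (carrier (QF klein TYPE('k))) = 2 * n\<^sup>2" .
qed

lemma primitive_root_2: "(1::'k::field) \<noteq> -1 \<Longrightarrow> primitive_root_of_unity 2 (-1::'k)"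
  unfolding primitive_root_of_unity_def by (auto simp: less_2_cases_iff)

lemma primitive_root_4_iff:
  assumes char: "(1::'k::field) \<noteq> -1"
  shows "primitive_root_of_unity 4 (i::'k) \<longleftrightarrow> i\<^sup>2 = -1"
proof
  assume "primitive_root_of_unity 4 i"
  then have "(i\<^sup>2)\<^sup>2 = 1" "i\<^sup>2 \<noteq> 1" by (auto simp: primitive_root_of_unity_def)
  then show "i\<^sup>2 = -1" using power2_eq_1_iff[of "i\<^sup>2"] by blast
next
  assume i: "i\<^sup>2 = -1"
  have "i ^ 4 = (i\<^sup>2)\<^sup>2" by simp
  then have "i ^ 4 = 1" using i by (simp del: power2_eq_iff)
  moreover have "i ^ m \<noteq> 1" if "0 < m" "m < 4" for m
  proof -
    have "m = 1 \<or> m = 2 \<or> m = 3" using that by linarith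
    moreover have "i \<noteq> 1" using i char by auto
    moreover have "i ^ 3 = - i" using i by (simp add: power3_eq_cube power2_eq_square)
    moreover have "i \<noteq> - 1" using i char by auto
    ultimately show ?thesis using i char by (auto simp: minus_equation_iff[of i])
  qed
  ultimately show "primitive_root_of_unity 4 i" by (simp add: primitive_root_of_unity_def)
qed

theorem mainTheorem5:
  assumes "CHAR('k::field) \<noteq> 2"
  shows
    "((\<nexists>i::'k. primitive_root_of_unity 4 i) \<longrightarrow>
        H3_ab klein TYPE('k) \<cong> QF klein TYPE('k) \<and>
        QF klein TYPE('k) \<cong>
          integer_mod_group 2 \<times>\<times> integer_mod_group 2 \<times>\<times> integer_mod_group 2 \<and>
        card (carrier (H3_ab klein TYPE('k))) = 8 \<and>
        (\<forall>c \<in> carrier (H3_ab klein TYPE('k)). \<exists>R. (trivial_cocycle3 klein, R) \<in> c))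
     \<and>
     ((\<exists>i::'k. primitive_root_of_unity 4 i) \<longrightarrow>
        H3_ab klein TYPE('k) \<cong> QF klein TYPE('k) \<and>
        QF klein TYPE('k) \<cong>
          integer_mod_group 4 \<times>\<times> integer_mod_group 4 \<times>\<times> integer_mod_group 2 \<and>
        card (carrier (H3_ab klein TYPE('k))) = 32 \<and>
        card (classes_over klein (trivial_cocycle3 klein :: _ \<Rightarrow> 'k)) = 8 \<and>
        (\<forall>X \<subseteq> {kl_sigma, kl_tau, kl_rho}. card X = 2 \<longrightarrow>
           card (classes_over klein (phi_of X :: _ \<Rightarrow> 'k)) = 8) \<and>
        (\<Union>X \<in> {X. X \<subseteq> {kl_sigma, kl_tau, kl_rho} \<and> card X = 2}.
           classes_over klein (phi_of X :: _ \<Rightarrow> 'k)) =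
          carrier (H3_ab klein TYPE('k)) -
            classes_over klein (trivial_cocycle3 klein :: _ \<Rightarrow> 'k) \<and>
        card (carrier (H3_ab klein TYPE('k)) -
            classes_over klein (trivial_cocycle3 klein :: _ \<Rightarrow> 'k)) = 24)"
proof (intro conjI[of "_ \<longrightarrow> _"] impI)
  have "\<not> CHAR('k) dvd 2"
  proof
    assume d: "CHAR('k) dvd 2"
    then have "CHAR('k) \<le> 2" by (rule dvd_imp_le) simp
    moreover have "CHAR('k) \<noteq> 0" using d by (metis dvd_0_left zero_neq_numeral)
    ultimately show False using assms CHAR_not_1[where 'a = 'k] by linarith
  qed
  then have "of_nat 2 \<noteq> (0::'k)" unfolding of_nat_eq_0_iff_char_dvd .
  then have char: "(1::'k) \<noteq> -1" by (metis add.right_inverse of_nat_numeral one_add_one)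
  have iso: "H3_ab klein TYPE('k) \<cong> QF klein TYPE('k)"
    using class_trace_iso unfolding is_iso_def by blast
  have bij: "bij_betw (class_trace klein) (carrier (H3_ab klein TYPE('k))) (carrier (QF klein TYPE('k)))"
    using class_trace_iso by (auto simp: iso_def)
  then have trace_QF: "class_trace klein c \<in> carrier (QF klein TYPE('k))"
    if "c \<in> carrier (H3_ab klein TYPE('k))" for c
    using that by (rule bij_betwE[rule_format])
  have card_H3: "card (carrier (H3_ab klein TYPE('k))) = card (carrier (QF klein TYPE('k)))"
    using bij by (rule bij_betw_same_card)
  note over_iff = klein_class_over_iff[OF char]
  have support: "quartic_support Q \<subseteq> {kl_sigma, kl_tau, kl_rho}"
      "quartic_support Q = {} \<or> card (quartic_support Q) = 2"
    if Q: "Q \<in> carrier (QF klein TYPE('k))" for Q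
  proof -
    obtain s t r where "Q = klein_fun s t r" using Q unfolding mem_QF_klein_iff by blast
    then show sub: "quartic_support Q \<subseteq> {kl_sigma, kl_tau, kl_rho}"
      unfolding quartic_support_def klein_table(1) by auto
    show "quartic_support Q = {} \<or> card (quartic_support Q) = 2"
      using sgn_of_quartic_support_prod[OF Q] unfolding sgn_of_prod_iff[OF char sub] .
  qed
  {
    assume no: "\<nexists>i::'k. primitive_root_of_unity 4 i"
    have sq: "x\<^sup>2 = 1" if "x ^ 4 = 1" for x :: 'k
    proof -
      have "(x\<^sup>2)\<^sup>2 = 1" using that by simp
      then show ?thesis
        using no power2_eq_1_iff[of "x\<^sup>2"] unfolding primitive_root_4_iff[OF char] by blast
    qed
    have all: "\<exists>m<2. x = (-1) ^ m" if "x ^ 4 = 1" for x :: 'k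
    proof -
      have "x = (-1) ^ 0 \<or> x = (-1) ^ 1" using sq[OF that] by (simp add: power2_eq_1_iff)
      then show ?thesis by (elim disjE) (auto intro: exI[of _ 0] exI[of _ 1])
    qed
    note Q = QF_klein_iso[OF char primitive_root_2[OF char] _ all, simplified]
    show "H3_ab klein TYPE('k) \<cong> QF klein TYPE('k) \<and>
        QF klein TYPE('k) \<cong>
          integer_mod_group 2 \<times>\<times> integer_mod_group 2 \<times>\<times> integer_mod_group 2 \<and>
        card (carrier (H3_ab klein TYPE('k))) = 8 \<and>
        (\<forall>c \<in> carrier (H3_ab klein TYPE('k)). \<exists>R. (trivial_cocycle3 klein, R) \<in> c)"
    proof (intro conjI ballI)
      fix c assume c: "c \<in> carrier (H3_ab klein TYPE('k))"
      have "quartic_support (class_trace klein c) = {}"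
      proof -
        obtain s t r where q: "class_trace klein c = klein_fun s t r" "s ^ 4 = 1" "t ^ 4 = 1" "r\<^sup>2 = s\<^sup>2 * t\<^sup>2"
          using trace_QF[OF c] unfolding mem_QF_klein_iff by blast
        then show ?thesis using sq unfolding quartic_support_def klein_table(1) by auto
      qed
      then have "c \<in> classes_over klein (phi_of {} :: _ \<Rightarrow> 'k)"
        using over_iff[OF _ c] by simp
      then show "\<exists>R. (trivial_cocycle3 klein, R) \<in> c"
        unfolding phi_of_empty classes_over_def by blast
    qed (use iso Q card_H3 in simp_all)
  next
    assume "\<exists>i::'k. primitive_root_of_unity 4 i"
    then obtain i :: 'k where i: "primitive_root_of_unity 4 i" by blast
    have i2: "i\<^sup>2 = -1" using i unfolding primitive_root_4_iff[OF char] .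
    have all: "\<exists>m<4. x = i ^ m" if "x ^ 4 = 1" for x :: 'k
    proof -
      have "(x\<^sup>2)\<^sup>2 = 1" using that by simp
      then have "x\<^sup>2 = 1\<^sup>2 \<or> x\<^sup>2 = i\<^sup>2"
        using power2_eq_1_iff[of "x\<^sup>2"] unfolding i2 by simp
      then have "x = 1 \<or> x = -1 \<or> x = i \<or> x = - i" unfolding power2_eq_iff by blast
      moreover have "i ^ 3 = - i" using i2 by (simp add: power3_eq_cube power2_eq_square)
      ultimately have "x = i ^ 0 \<or> x = i ^ 2 \<or> x = i ^ 1 \<or> x = i ^ 3"
        unfolding i2 by auto
      then show ?thesis by (elim disjE) (auto intro: exI[of _ 0] exI[of _ 1] exI[of _ 2] exI[of _ 3])
    qed
    have i4: "i ^ 4 = 1" using i by (simp add: primitive_root_of_unity_def)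
    note Q = QF_klein_iso[OF char i i4 all]
    have root: "\<exists>w::'k. w\<^sup>2 = sgn_of X x" for X x
      using i2 by (auto simp: sgn_of_def intro: exI[of _ 1])
    have card_over: "card (classes_over klein (phi_of X :: _ \<Rightarrow> 'k)) = 8"
      if "X \<subseteq> {kl_sigma, kl_tau, kl_rho}" "X = {} \<or> card X = 2" for X
      using card_classes_over_phi_of[OF char that(1) _ root] that(2)
      unfolding sgn_of_prod_iff[OF char that(1)] by blast
    have card_trivial: "card (classes_over klein (trivial_cocycle3 klein :: _ \<Rightarrow> 'k)) = 8"
      using card_over[of "{}"] unfolding phi_of_empty by simp
    have H32: "card (carrier (H3_ab klein TYPE('k))) = 32" using card_H3 Q(2) by simp
    have "classes_over klein (trivial_cocycle3 klein :: _ \<Rightarrow> 'k) \<subseteq> carrier (H3_ab klein TYPE('k))"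
      by (auto simp: classes_over_def)
    moreover have "finite (classes_over klein (trivial_cocycle3 klein :: _ \<Rightarrow> 'k))"
      using card_trivial by (intro card_ge_0_finite) simp
    ultimately have card_rest: "card (carrier (H3_ab klein TYPE('k)) -
            classes_over klein (trivial_cocycle3 klein :: _ \<Rightarrow> 'k)) = 24"
      using H32 card_trivial by (simp add: card_Diff_subset)
    have rest: "(\<Union>X \<in> {X. X \<subseteq> {kl_sigma, kl_tau, kl_rho} \<and> card X = 2}.
           classes_over klein (phi_of X :: _ \<Rightarrow> 'k)) =
          carrier (H3_ab klein TYPE('k)) -
            classes_over klein (trivial_cocycle3 klein :: _ \<Rightarrow> 'k)" (is "?U = ?D")
    proof (rule Set.set_eqI)
      fix c
      show "c \<in> ?U \<longleftrightarrow> c \<in> ?D"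
      proof (cases "c \<in> carrier (H3_ab klein TYPE('k))")
        case c: True
        have "c \<in> ?U \<longleftrightarrow> card (quartic_support (class_trace klein c)) = 2"
          using over_iff[OF _ c] support(1)[OF trace_QF[OF c]] by auto
        moreover have "c \<in> ?D \<longleftrightarrow> quartic_support (class_trace klein c) \<noteq> {}"
          using over_iff[OF _ c, of "{}"] c unfolding phi_of_empty by auto
        ultimately show ?thesis using support(2)[OF trace_QF[OF c]] by auto
      qed (auto simp: classes_over_def)
    qed
    show "H3_ab klein TYPE('k) \<cong> QF klein TYPE('k) \<and>
        QF klein TYPE('k) \<cong>
          integer_mod_group 4 \<times>\<times> integer_mod_group 4 \<times>\<times> integer_mod_group 2 \<and>
        card (carrier (H3_ab klein TYPE('k))) = 32 \<and>
        card (classes_over klein (trivial_cocycle3 klein :: _ \<Rightarrow> 'k)) = 8 \<and>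
        (\<forall>X \<subseteq> {kl_sigma, kl_tau, kl_rho}. card X = 2 \<longrightarrow>
           card (classes_over klein (phi_of X :: _ \<Rightarrow> 'k)) = 8) \<and>
        (\<Union>X \<in> {X. X \<subseteq> {kl_sigma, kl_tau, kl_rho} \<and> card X = 2}.
           classes_over klein (phi_of X :: _ \<Rightarrow> 'k)) =
          carrier (H3_ab klein TYPE('k)) -
            classes_over klein (trivial_cocycle3 klein :: _ \<Rightarrow> 'k) \<and>
        card (carrier (H3_ab klein TYPE('k)) -
            classes_over klein (trivial_cocycle3 klein :: _ \<Rightarrow> 'k)) = 24"
      using iso Q(1) H32 card_trivial card_over rest card_rest by blast
  }
qed

end
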